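(* Let $\rho_0>0$ and let $\rho(t)$ be a solution of the Kac--van Moerbeke lattice $$\dot\rho(n,t)=\rho(n,t)\big(\rho(n+1,t)^2-\rho(n-1,t)^2\big)$$ satisfying $$\sum_{n\in\mathbb{Z}}|n|\,|\rho(n,t)-\rho_0|<\infty$$ for one (and hence for all) $t\in\mathbb{R}$. Suppose that for two different times $t_0<t_1$, some constant $\delta>0$ and some constant $C$, we have $$\sum_{n\geq M}|\rho(n,t_j)-\rho_0|\leq C\frac{1}{M^{(1+\delta)2M}},\qquad M>0,\quad j\in\{0,1\}.$$ Then $$\rho(n,t)=\rho_0,\qquad (n,t)\in\mathbb{Z}\times\mathbb{R}.$$
   Context: The Kac--van Moerbeke lattice is written in Flaschka's variables. Here $\rho(t)=(\rho(n,t))_{n\in\mathbb{Z}}$ is a sequence depending on time $t\in\mathbb{R}$, the equation is required for all $n\in\mathbb{Z}$, and the dot denotes the derivative with respect to $t$.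
   Formalization: Solutions are taken positive (else ρ(0,t)=-ρ0, ρ(n,t)=ρ0 for n≠0 is a counterexample) and bounded in n, locally uniformly in t, the class in which summability at one time gives it at all times. *)

theory Defs
  imports "HOL-Analysis.Analysis"
begin

text \<open>
  Solutions of the Kac--van Moerbeke lattice in Flaschka's variables; \<open>\<rho> n t\<close> is the value at
  site \<open>n\<close> and time \<open>t\<close>.  The phase space consists of the bounded sequences of positive numbers.

  Positivity: Flaschka's variables are exponentials.  The equation itself is insensitive to
  changing the sign of \<open>\<rho>\<close> at a single site.

  Boundedness: as usual for this lattice, \<open>t \<mapsto> \<rho>(t)\<close> is a curve in \<open>\<ell>\<^sup>\<infinity>(\<int>)\<close>.  Only boundedness on
  compact time intervals is required; by the equation this already makes the curve
  continuously differentiable in the supremum norm.  It is the class in which decay of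
  \<open>\<rho>(t) - \<rho>\<^sub>0\<close> at one time propagates to all times.
\<close>

definition kvm_solution :: "(int \<Rightarrow> real \<Rightarrow> real) \<Rightarrow> bool" where
  "kvm_solution \<rho> \<longleftrightarrow>
     (\<forall>n t. \<rho> n t > 0) \<and>
     (\<forall>T. bounded {\<rho> n t | n t. \<bar>t\<bar> \<le> T}) \<and>
     (\<forall>n t. (\<rho> n has_real_derivative \<rho> n t * ((\<rho> (n + 1) t)\<^sup>2 - (\<rho> (n - 1) t)\<^sup>2)) (at t))"

end

theory Submission
  imports Defs "HOL-Complex_Analysis.Complex_Analysis"
begin

text \<open>
  Let \<open>H u(n) = \<rho>(n) u(n + 1) + \<rho>(n - 1) u(n - 1)\<close> be the Jacobi operator of the Lax pair, with spectral
  parameter \<open>\<rho>\<^sub>0 (k + 1 / k)\<close>, \<open>v = k\<^sup>2\<close>, \<open>\<bar>k\<bar> < 1\<close>, and let \<open>u\<close> be its Weyl solution at \<open>-\<infinity>\<close>.  The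
  relative deviation \<open>\<xi>(n, v)\<close> of \<open>u(n - 1) / u(n)\<close> from its unperturbed value is holomorphic in \<open>v\<close>
  near \<open>0\<close> and satisfies a contractive recurrence in \<open>n\<close> and a Riccati equation in \<open>t\<close>.  The limit
  \<open>z(v, t) = lim \<xi>(n, v) / v\<^sup>n\<close> as \<open>n \<rightarrow> \<infinity>\<close> is, up to normalisation, the reflection coefficient, and the Riccati
  equation linearises to \<open>z' = 2 \<rho>\<^sub>0\<^sup>2 (v - 1 / v) z\<close>.

  The decay hypothesis at \<open>t\<^sub>0\<close> and \<open>t\<^sub>1\<close> says that \<open>z\<close> grows at both times more slowly than
  \<open>exp (\<epsilon> / \<bar>v\<bar>)\<close> for each \<open>\<epsilon> > 0\<close>, while the evolution multiplies it by a factor that decays like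
  \<open>exp (- c Re (1 / v))\<close>.  Hence \<open>z(v) z(-v) z(\<i>v) z(-\<i>v)\<close> at time \<open>t\<^sub>1\<close> decays exponentially in \<open>1 / \<bar>v\<bar>\<close> in
  every direction, has a zero of infinite order at \<open>0\<close>, and vanishes, so \<open>z = 0\<close>.  Together with the
  superexponential decay of \<open>\<rho> - \<rho>\<^sub>0\<close> this forces \<open>\<xi> = 0\<close>, that is, \<open>\<rho> = \<rho>\<^sub>0\<close> at time \<open>t\<^sub>1\<close> and so always.
\<close>

section \<open>The Weyl function\<close>

text \<open>Small enough that \<open>norm v \<le> radius B\<close> and
  \<open>norm x \<le> 2 * B + 1\<close> give \<open>norm (v * x) \<le> 1/4\<close>, while
  \<open>(1 + B) * radius B = 1/8\<close> makes one step of the recurrence a contraction.\<close>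

definition radius :: "real \<Rightarrow> real" where
  "radius B = 1 / (8 * (B + 1))"

text \<open>With \<open>\<beta>(n) = 1 - \<rho>(n)\<^sup>2 / \<rho>\<^sub>0\<^sup>2\<close> and \<open>\<lambda> = \<rho>\<^sub>0 (k + 1 / k)\<close>, the value \<open>x\<close> at site \<open>n\<close> is defined by
  \<open>\<lambda> \<rho>(n - 1) u(n - 1) / u(n) = \<rho>\<^sub>0\<^sup>2 (1 + v) (1 + x)\<close>.  The equation \<open>H u = \<lambda> u\<close> then gives the value
  \<open>weyl_step (\<beta> n) v x\<close> at site \<open>n + 1\<close>.\<close>

definition weyl_step :: "real \<Rightarrow> complex \<Rightarrow> complex \<Rightarrow> complex" where
  "weyl_step b v x = (v * x - of_real b) / (1 - v * x)"

text \<open>The unperturbed value 0 is prescribed at site n - m and carried m steps to the right, so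
  that m -> infinity moves the starting site to -infinity and selects the Weyl solution
  there.\<close>

primrec weyl_approx :: "(int \<Rightarrow> real) \<Rightarrow> nat \<Rightarrow> int \<Rightarrow> complex \<Rightarrow> complex" where
  "weyl_approx \<beta> 0 n v = 0"
| "weyl_approx \<beta> (Suc m) n v = weyl_step (\<beta> (n - 1)) v (weyl_approx \<beta> m (n - 1) v)"

definition weyl :: "(int \<Rightarrow> real) \<Rightarrow> int \<Rightarrow> complex \<Rightarrow> complex" where
  "weyl \<beta> n v = lim (\<lambda>m. weyl_approx \<beta> m n v)"

section \<open>Estimates for one step of the recurrence\<close>

lemma radius_pos: "B \<ge> 0 \<Longrightarrow> radius B > 0"
  by (simp add: radius_def)

lemma radius_le: "B \<ge> 0 \<Longrightarrow> radius B \<le> 1/8"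
  by (simp add: radius_def field_simps)

lemma norm_mult_le_quarter:
  fixes v x :: complex
  assumes "B \<ge> 0" "norm v \<le> radius B" "norm x \<le> 2 * B + 1"
  shows "norm (v * x) \<le> 1/4"
proof -
  have "norm (v * x) \<le> radius B * (2 * B + 1)"
    unfolding norm_mult using assms radius_pos[of B] by (intro mult_mono) auto
  also have "\<dots> \<le> 1/4"
    using assms(1) by (simp add: radius_def field_simps)
  finally show ?thesis .
qed

lemma norm_one_minus_ge:
  fixes z :: complex
  assumes "norm z \<le> c"
  shows "norm (1 - z) \<ge> 1 - c"
  using norm_triangle_ineq2[of 1 z] assms by simp

lemma weyl_step_minus_one:
  assumes "v * x \<noteq> 1"
  shows "weyl_step b v x = (1 - of_real b) / (1 - v * x) - 1"
  using assms by (simp add: weyl_step_def field_simps)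

lemma norm_weyl_step_le:
  assumes "norm (v * x) \<le> 1/4"
  shows "norm (weyl_step b v x) \<le> 4/3 * (norm (v * x) + \<bar>b\<bar>)"
proof -
  have 1: "norm (1 - v * x) \<ge> 3/4"
    using norm_one_minus_ge[OF assms] by simp
  have "norm (v * x - of_real b) \<le> norm (v * x) + \<bar>b\<bar>"
    by (metis norm_of_real norm_triangle_ineq4)
  then have "norm (weyl_step b v x) \<le> (norm (v * x) + \<bar>b\<bar>) / (3/4)"
    unfolding weyl_step_def norm_divide using 1 by (intro frac_le) auto
  then show ?thesis by simp
qed

lemma weyl_step_bounded:
  assumes "B \<ge> 0" "norm v \<le> radius B" "norm x \<le> 2 * B + 1" "\<bar>b\<bar> \<le> B"
  shows "norm (weyl_step b v x) \<le> 2 * B + 1"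
  using norm_weyl_step_le[OF norm_mult_le_quarter[OF assms(1-3)], of b]
    norm_mult_le_quarter[OF assms(1-3)] assms by argo

text \<open>For different x and y this is the difference quotient of \<open>weyl_step b v\<close>,
  for x = y its derivative; the first governs the convergence of the iteration, the second its time
  derivative. The bound obtained is (1/8) / (9/16) = 2/9.\<close>

lemma weyl_step_contraction_factor:
  fixes v x y :: complex
  assumes "B \<ge> 0" "norm v \<le> radius B" "norm x \<le> 2 * B + 1" "norm y \<le> 2 * B + 1" "\<bar>b\<bar> \<le> B"
  shows "norm ((1 - of_real b) * v / ((1 - v * x) * (1 - v * y))) \<le> 1/2"
proof -
  have d: "norm (1 - v * x) \<ge> 3/4" "norm (1 - v * y) \<ge> 3/4"
    using norm_one_minus_ge[OF norm_mult_le_quarter[OF assms(1,2,3)]]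
      norm_one_minus_ge[OF norm_mult_le_quarter[OF assms(1,2,4)]] by auto
  have "norm (1 - of_real b :: complex) \<le> 1 + B"
    using norm_triangle_ineq4[of 1 "of_real b :: complex"] assms by simp
  then have "norm ((1 - of_real b) * v) \<le> (1 + B) * radius B"
    unfolding norm_mult using assms by (intro mult_mono) auto
  also have "\<dots> = 1/8"
    using assms(1) by (simp add: radius_def field_simps)
  finally have "norm ((1 - of_real b) * v) \<le> 1/8" .
  moreover have "norm ((1 - v * x) * (1 - v * y)) \<ge> (3/4) * (3/4)"
    unfolding norm_mult using d by (intro mult_mono) auto
  ultimately have "norm ((1 - of_real b) * v / ((1 - v * x) * (1 - v * y))) \<le> (1/8) / ((3/4) * (3/4))"
    unfolding norm_divide by (intro frac_le) auto
  then show ?thesis by simp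
qed

lemma mult_ne_one:
  fixes v x :: complex
  assumes "B \<ge> 0" "norm v \<le> radius B" "norm x \<le> 2 * B + 1"
  shows "v * x \<noteq> 1"
  using norm_mult_le_quarter[OF assms] by auto

lemma weyl_step_contraction:
  assumes "B \<ge> 0" "norm v \<le> radius B" "norm x \<le> 2 * B + 1" "norm y \<le> 2 * B + 1" "\<bar>b\<bar> \<le> B"
  shows "norm (weyl_step b v x - weyl_step b v y) \<le> norm (x - y) / 2"
proof -
  have ne: "v * x \<noteq> 1" "v * y \<noteq> 1"
    using mult_ne_one assms by auto
  have "weyl_step b v x - weyl_step b v y =
      (1 - of_real b) * v / ((1 - v * x) * (1 - v * y)) * (x - y)"
    using ne by (simp add: weyl_step_minus_one divide_simps) (simp add: algebra_simps)
  then have "norm (weyl_step b v x - weyl_step b v y) =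
      norm ((1 - of_real b) * v / ((1 - v * x) * (1 - v * y))) * norm (x - y)"
    by (simp only: norm_mult)
  also have "\<dots> \<le> 1/2 * norm (x - y)"
    by (intro mult_right_mono weyl_step_contraction_factor[OF assms]) auto
  finally show ?thesis by simp
qed

section \<open>Convergence and holomorphy of the iteration\<close>

context
  fixes \<beta> :: "int \<Rightarrow> real" and B :: real
  assumes bdd: "\<And>n. \<bar>\<beta> n\<bar> \<le> B"
begin

lemma bound_nonneg: "B \<ge> 0"
  using bdd[of 0] by linarith

lemma weyl_approx_bounded:
  assumes "norm v \<le> radius B"
  shows "norm (weyl_approx \<beta> m n v) \<le> 2 * B + 1"
  by (induction m arbitrary: n)
    (use bound_nonneg assms bdd in \<open>auto intro!: weyl_step_bounded\<close>)

lemma weyl_approx_diff: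
  assumes "norm v \<le> radius B"
  shows "norm (weyl_approx \<beta> (Suc m) n v - weyl_approx \<beta> m n v) \<le> (2 * B + 1) / 2 ^ m"
proof (induction m arbitrary: n)
  case 0
  show ?case using weyl_approx_bounded[OF assms, of 1 n] by simp
next
  case (Suc m)
  have "norm (weyl_approx \<beta> (Suc (Suc m)) n v - weyl_approx \<beta> (Suc m) n v)
     \<le> norm (weyl_approx \<beta> (Suc m) (n - 1) v - weyl_approx \<beta> m (n - 1) v) / 2"
    unfolding weyl_approx.simps(2)[of _ _ n v] using assms weyl_approx_bounded
    by (intro weyl_step_contraction[OF bound_nonneg] bdd) (rule assms weyl_approx_bounded)+
  then show ?case using Suc.IH[of "n - 1"] by simp
qed

text \<open>The factor 1 - 1 / 2 ^ k comes from the exact partial geometric sum, which lets the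
  induction on k close.\<close>

lemma weyl_approx_telescope:
  assumes "norm v \<le> radius B"
  shows "norm (weyl_approx \<beta> (m + k) n v - weyl_approx \<beta> m n v) \<le> 2 * (2 * B + 1) / 2 ^ m * (1 - 1 / 2 ^ k)"
proof (induction k)
  case (Suc k)
  have "norm (weyl_approx \<beta> (m + Suc k) n v - weyl_approx \<beta> m n v)
     \<le> norm (weyl_approx \<beta> (Suc (m + k)) n v - weyl_approx \<beta> (m + k) n v)
       + norm (weyl_approx \<beta> (m + k) n v - weyl_approx \<beta> m n v)"
    by (metis add_Suc_right norm_diff_triangle_le order_refl)
  also have "\<dots> \<le> (2 * B + 1) / 2 ^ (m + k) + 2 * (2 * B + 1) / 2 ^ m * (1 - 1 / 2 ^ k)"
    by (intro add_mono weyl_approx_diff assms Suc.IH)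
  also have "\<dots> = 2 * (2 * B + 1) / 2 ^ m * (1 - 1 / 2 ^ Suc k)"
    by (simp add: field_simps power_add)
  finally show ?case .
qed simp

lemma weyl_approx_Cauchy_bound:
  assumes "norm v \<le> radius B" "m \<le> m'"
  shows "norm (weyl_approx \<beta> m' n v - weyl_approx \<beta> m n v) \<le> 2 * (2 * B + 1) / 2 ^ m"
proof -
  have "norm (weyl_approx \<beta> m' n v - weyl_approx \<beta> m n v) \<le> 2 * (2 * B + 1) / 2 ^ m * (1 - 1 / 2 ^ (m' - m))"
    using weyl_approx_telescope[OF assms(1), of m "m' - m" n] assms(2) by simp
  also have "\<dots> \<le> 2 * (2 * B + 1) / 2 ^ m * 1"
    using bound_nonneg by (intro mult_left_mono) auto
  finally show ?thesis by simp
qed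

lemma geometric_bound_tendsto: "(\<lambda>m. 2 * (2 * B + 1) / 2 ^ m) \<longlonglongrightarrow> 0"
  by real_asymp

lemma weyl_approx_tendsto:
  assumes "norm v \<le> radius B"
  shows "(\<lambda>m. weyl_approx \<beta> m n v) \<longlonglongrightarrow> weyl \<beta> n v"
proof -
  have "Cauchy (\<lambda>m. weyl_approx \<beta> m n v)"
  proof (rule CauchyI)
    fix e :: real assume "e > 0"
    then have "\<forall>\<^sub>F m in sequentially. 2 * (2 * B + 1) / 2 ^ m < e / 2"
      using order_tendstoD(2)[OF geometric_bound_tendsto, of "e/2"] by simp
    then obtain M where M: "2 * (2 * B + 1) / 2 ^ M < e / 2"
      using eventually_happens'[OF sequentially_bot] by blast
    have "norm (weyl_approx \<beta> m n v - weyl_approx \<beta> m' n v) < e" if "m \<ge> M" "m' \<ge> M" for m m'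
      using weyl_approx_Cauchy_bound[OF assms that(1), of n] weyl_approx_Cauchy_bound[OF assms that(2), of n] M
        norm_triangle_ineq4[of "weyl_approx \<beta> m n v - weyl_approx \<beta> M n v" "weyl_approx \<beta> m' n v - weyl_approx \<beta> M n v"]
      unfolding diff_diff_eq2 diff_add_cancel by linarith
    then show "\<exists>M. \<forall>m\<ge>M. \<forall>n'\<ge>M. norm (weyl_approx \<beta> m n v - weyl_approx \<beta> n' n v) < e"
      by blast
  qed
  then show ?thesis
    unfolding weyl_def using Cauchy_convergent convergent_LIMSEQ_iff by blast
qed

lemma weyl_approx_error:
  assumes "norm v \<le> radius B"
  shows "norm (weyl_approx \<beta> m n v - weyl \<beta> n v) \<le> 2 * (2 * B + 1) / 2 ^ m"
proof -
  have "(\<lambda>m'. norm (weyl_approx \<beta> m n v - weyl_approx \<beta> m' n v)) \<longlonglongrightarrow> norm (weyl_approx \<beta> m n v - weyl \<beta> n v)"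
    by (intro tendsto_intros weyl_approx_tendsto assms)
  moreover have "\<forall>m'\<ge>m. norm (weyl_approx \<beta> m n v - weyl_approx \<beta> m' n v) \<le> 2 * (2 * B + 1) / 2 ^ m"
    using weyl_approx_Cauchy_bound[OF assms] by (metis norm_minus_commute)
  ultimately show ?thesis
    by (meson LIMSEQ_le_const2)
qed

lemma weyl_bounded:
  assumes "norm v \<le> radius B"
  shows "norm (weyl \<beta> n v) \<le> 2 * B + 1"
  by (rule LIMSEQ_le_const2[OF tendsto_norm[OF weyl_approx_tendsto[OF assms]]])
    (use weyl_approx_bounded[OF assms] in blast)

lemma weyl_recurrence:
  assumes "norm v \<le> radius B"
  shows "weyl \<beta> (n + 1) v = weyl_step (\<beta> n) v (weyl \<beta> n v)"
proof (rule LIMSEQ_unique)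
  show "(\<lambda>m. weyl_approx \<beta> (Suc m) (n + 1) v) \<longlonglongrightarrow> weyl \<beta> (n + 1) v"
    using weyl_approx_tendsto[OF assms] by (rule LIMSEQ_Suc)
  have "(\<lambda>m. weyl_step (\<beta> n) v (weyl_approx \<beta> m n v)) \<longlonglongrightarrow> weyl_step (\<beta> n) v (weyl \<beta> n v)"
    unfolding weyl_step_def
    using mult_ne_one[OF bound_nonneg assms weyl_bounded[OF assms], of n]
    by (intro tendsto_intros weyl_approx_tendsto assms) auto
  then show "(\<lambda>m. weyl_approx \<beta> (Suc m) (n + 1) v) \<longlonglongrightarrow> weyl_step (\<beta> n) v (weyl \<beta> n v)"
    by simp
qed

text \<open>At v = 0 the step forgets its argument, so the potential can be read off from the Weyl
  function; the rigidity argument combines this with the maximum principle.\<close>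

lemma weyl_at_0: "weyl \<beta> n 0 = - of_real (\<beta> (n - 1))"
  using weyl_recurrence[of 0 "n - 1"] radius_pos[OF bound_nonneg] by (simp add: weyl_step_def)

lemma weyl_approx_holomorphic: "weyl_approx \<beta> m n holomorphic_on ball 0 (radius B)"
proof (induction m arbitrary: n)
  case 0
  then show ?case by (simp add: holomorphic_on_def)
next
  case (Suc m)
  have "1 - v * weyl_approx \<beta> m (n - 1) v \<noteq> 0" if "v \<in> ball 0 (radius B)" for v
    using mult_ne_one[OF bound_nonneg _ weyl_approx_bounded, of v v m "n - 1"] that by auto
  then show ?case
    unfolding weyl_approx.simps weyl_step_def
    by (intro holomorphic_intros Suc.IH[unfolded eta_contract_eq] ballI) (auto intro: Suc.IH)
qed

lemma weyl_holomorphic: "weyl \<beta> n holomorphic_on ball 0 (radius B)"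
proof (rule holomorphic_uniform_sequence[where f = "\<lambda>m. weyl_approx \<beta> m n"])
  fix v :: complex assume "v \<in> ball 0 (radius B)"
  then obtain d where d: "d > 0" "cball v d \<subseteq> ball 0 (radius B)"
    using open_contains_cball by blast
  have "uniform_limit (cball v d) (\<lambda>m. weyl_approx \<beta> m n) (weyl \<beta> n) sequentially"
  proof (rule uniform_limitI)
    fix e :: real assume "e > 0"
    from order_tendstoD(2)[OF geometric_bound_tendsto this]
    show "\<forall>\<^sub>F m in sequentially. \<forall>x\<in>cball v d. dist (weyl_approx \<beta> m n x) (weyl \<beta> n x) < e"
    proof (rule eventually_mono, intro ballI)
      fix m x assume m: "2 * (2 * B + 1) / 2 ^ m < e" and "x \<in> cball v d"
      then have "norm x \<le> radius B" using d by force
      from weyl_approx_error[OF this, of m n] m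
      show "dist (weyl_approx \<beta> m n x) (weyl \<beta> n x) < e" by (simp add: dist_norm)
    qed
  qed
  with d show "\<exists>d>0. cball v d \<subseteq> ball 0 (radius B) \<and>
      uniform_limit (cball v d) (\<lambda>m. weyl_approx \<beta> m n) (weyl \<beta> n) sequentially" by blast
qed (auto intro: weyl_approx_holomorphic)

end

section \<open>The Riccati equation\<close>

lemma has_vector_derivative_weyl_step:
  assumes x: "(x has_vector_derivative x') (at t within S)"
    and b: "(b has_real_derivative b') (at t within S)"
    and ne: "v * x t \<noteq> 1"
  shows "((\<lambda>s. weyl_step (b s) v (x s)) has_vector_derivative
     ((1 - of_real (b t)) * v * x' / (1 - v * x t)\<^sup>2 - of_real b' / (1 - v * x t))) (at t within S)"
proof -
  have b'': "((\<lambda>s. of_real (b s) :: complex) has_derivative (\<lambda>h. h *\<^sub>R of_real b')) (at t within S)"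
    using has_derivative_of_real[OF b[unfolded has_field_derivative_def]]
    by (auto simp: scaleR_conv_of_real mult.commute)
  have x'': "(x has_derivative (\<lambda>h. h *\<^sub>R x')) (at t within S)"
    using x by (simp add: has_vector_derivative_def)
  have n: "((\<lambda>s. v * x s - of_real (b s)) has_derivative (\<lambda>h. v * (h *\<^sub>R x') - h *\<^sub>R of_real b')) (at t within S)"
    by (rule has_derivative_diff[OF has_derivative_mult_right[OF x''] b''])
  have d: "((\<lambda>s. 1 - v * x s) has_derivative (\<lambda>h. 0 - v * (h *\<^sub>R x'))) (at t within S)"
    by (rule has_derivative_diff[OF has_derivative_const has_derivative_mult_right[OF x'']])
  have ne': "1 - v * x t \<noteq> 0" using ne by auto
  \<comment> \<open>Here z stands for the denominator 1 - v x, so that v x - \<beta> becomes 1 - z -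
    \<beta>.\<close>
  have eq: "((v * (h *\<^sub>R x') - h *\<^sub>R of_real b') * z - (1 - z - \<beta>) * (0 - v * (h *\<^sub>R x'))) / (z * z)
    = h *\<^sub>R ((1 - \<beta>) * v * x' / z\<^sup>2 - of_real b' / z)" if "z \<noteq> 0" for z \<beta> h
    using that by (simp add: scaleR_conv_of_real divide_simps power2_eq_square) (simp add: algebra_simps)
  show ?thesis
    unfolding weyl_step_def has_vector_derivative_def
    by (rule has_derivative_eq_rhs[OF has_derivative_divide'[OF n d ne']])
      (use eq[OF ne', of _ "of_real (b t)"] in \<open>simp add: fun_eq_iff\<close>)
qed

text \<open>The velocity of x at site n under the lattice flow. Since (1 + v) (1 - 1 / v) = v - 1 /
  v, its linear part for \<beta> = 0 is \<kappa> (v - 1 / v) x; the application has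
  \<open>\<kappa> = 2 * \<rho>0\<^sup>2\<close>.\<close>

definition riccati :: "real \<Rightarrow> (int \<Rightarrow> real) \<Rightarrow> complex \<Rightarrow> int \<Rightarrow> complex \<Rightarrow> complex" where
  "riccati \<kappa> \<beta> v n x = of_real \<kappa> * ((1 + v) * (- (of_real (\<beta> (n - 1)) + x) / v + x + x\<^sup>2)
      + (1 + x) * (of_real (\<beta> (n - 1)) - of_real (\<beta> n)))"

text \<open>Here b2, b1, b0 stand for \<beta> at n - 2, n - 1, n, and x, y belong to the sites n - 1
  and n. Because 1 + y = (1 - b1) / d and b1 + y = v x (1 - b1) / d, both sides reduce to \<kappa>
  (1 - b1) / d times (1 + v) (y - x) + b1 - b0.\<close>

lemma riccati_weyl_step_aux:
  fixes \<kappa> b0 b1 b2 v x y G :: complex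
  assumes "v \<noteq> 0" "d = 1 - v * x" "d \<noteq> 0" "y = (v * x - b1) / d"
    and G: "G = \<kappa> * ((1 + v) * (- (b2 + x) / v + x + x\<^sup>2) + (1 + x) * (b2 - b1))"
  shows "(1 - b1) * v * G / d\<^sup>2 - \<kappa> * (1 - b1) * (b0 - b2) / d =
    \<kappa> * ((1 + v) * (- (b1 + y) / v + y + y\<^sup>2) + (1 + y) * (b1 - b0))"
proof -
  have "1 + y = (d + (v * x - b1)) / d" using assms(3,4) by (simp add: add_divide_distrib)
  then have y1: "1 + y = (1 - b1) / d" using assms(2) by simp
  have "b1 + y = (b1 * d + (v * x - b1)) / d" using assms(3,4) by (simp add: add_divide_distrib)
  then have y2: "b1 + y = v * x * (1 - b1) / d" unfolding assms(2) by (simp add: algebra_simps)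
  have "\<kappa> * ((1 + v) * (- (b1 + y) / v + y + y\<^sup>2) + (1 + y) * (b1 - b0))
     = \<kappa> * ((1 + v) * (- (b1 + y) / v + y * (1 + y)) + (1 + y) * (b1 - b0))"
    by (simp add: algebra_simps power2_eq_square)
  also have "\<dots> = \<kappa> * ((1 - b1) / d) * ((1 + v) * (y - x) + b1 - b0)"
    unfolding y1 y2 using assms(1,3) by (simp add: field_simps)
  also have "y - x = (v * x - b1 - d * x) / d" using assms by (simp add: field_simps)
  finally have R: "\<kappa> * ((1 + v) * (- (b1 + y) / v + y + y\<^sup>2) + (1 + y) * (b1 - b0)) =
    \<kappa> * ((1 - b1) / d) * ((1 + v) * ((v * x - b1 - d * x) / d) + b1 - b0)" .
  have "v * G = \<kappa> * ((1 + v) * (- (b2 + x) + v * x + v * x\<^sup>2) + v * (1 + x) * (b2 - b1))"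
    unfolding G using assms(1) by (simp add: field_simps)
  also have "\<dots> = \<kappa> * ((1 + v) * (v * x - b1 - d * x) + d * (b1 - b2))"
    unfolding assms(2) by (simp add: algebra_simps power2_eq_square)
  finally have vG: "v * G = \<kappa> * ((1 + v) * (v * x - b1 - d * x) + d * (b1 - b2))" .
  have "(1 - b1) * v * G / d\<^sup>2 - \<kappa> * (1 - b1) * (b0 - b2) / d =
    (1 - b1) * (v * G) / d\<^sup>2 - \<kappa> * (1 - b1) * (b0 - b2) / d" by simp
  also have "\<dots> = \<kappa> * ((1 - b1) / d) * ((1 + v) * ((v * x - b1 - d * x) / d) + b1 - b0)"
    unfolding vG using assms(3) by (simp add: field_simps power2_eq_square)
  finally show ?thesis using R by simp
qed

text \<open>The left-hand side is the chain rule of \<open>has_vector_derivative_weyl_step\<close>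
  with the lattice equation inserted for \<beta> (n - 1); the recurrence thus carries the Riccati
  flow at n - 1 to the one at n.\<close>

lemma riccati_weyl_step:
  assumes "v \<noteq> 0" "v * x \<noteq> 1"
  shows "(1 - of_real (\<beta> (n - 1))) * v * riccati \<kappa> \<beta> v (n - 1) x / (1 - v * x)\<^sup>2
      - of_real (\<kappa> * (1 - \<beta> (n - 1)) * (\<beta> n - \<beta> (n - 2))) / (1 - v * x)
    = riccati \<kappa> \<beta> v n (weyl_step (\<beta> (n - 1)) v x)"
proof -
  have "1 - v * x \<noteq> 0" using assms by auto
  from riccati_weyl_step_aux[OF assms(1) refl this refl refl,
      of "of_real (\<beta> (n - 1))" "of_real \<kappa>" "of_real (\<beta> (n - 2))" "of_real (\<beta> n)"]
  show ?thesis by (simp add: riccati_def weyl_step_def)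
qed

text \<open>Without its linear part the velocity is \<kappa> times (1 + v) x^2 - (1 + v) b / v + (1
  + x) (b - b'). For large n, where x has the size of v^n and \<beta> is much smaller, all of this
  is negligible after division by v^n.\<close>

lemma norm_riccati_minus_linear_le:
  fixes v x :: complex
  assumes "B \<ge> 0" "\<kappa> \<ge> 0" "0 < norm v" "norm v \<le> radius B" "norm x \<le> 2 * B + 1"
    and "norm x \<le> \<eta>" "\<bar>\<beta> (n - 1)\<bar> \<le> \<gamma>" "\<bar>\<beta> n\<bar> \<le> \<gamma>"
  shows "norm (riccati \<kappa> \<beta> v n x - of_real \<kappa> * (v - 1 / v) * x)
    \<le> \<kappa> * (2 * \<eta>\<^sup>2 + 8 * (B + 1) * \<gamma> / norm v)"
proof -
  define b b' where "b = (of_real (\<beta> (n - 1)) :: complex)" and "b' = (of_real (\<beta> n) :: complex)"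
  have v0: "v \<noteq> 0" using assms by auto
  have v1: "norm v \<le> 1/8" using assms radius_le[of B] by linarith
  have \<gamma>: "\<gamma> \<ge> 0" using assms by linarith
  have eq: "riccati \<kappa> \<beta> v n x - of_real \<kappa> * (v - 1 / v) * x =
    of_real \<kappa> * ((1 + v) * x\<^sup>2 - (1 + v) * b / v + (1 + x) * (b - b'))"
    unfolding riccati_def b_def[symmetric] b'_def[symmetric]
    using v0 by (simp add: field_simps power2_eq_square)
  have p: "norm (1 + v) \<le> 2" using norm_triangle_ineq[of 1 v] v1 by simp
  have x1: "norm (1 + x) \<le> 2 * B + 2" using norm_triangle_ineq[of 1 x] assms by simp
  have A1: "norm ((1 + v) * x\<^sup>2) \<le> 2 * \<eta>\<^sup>2"
    unfolding norm_mult norm_power using p assms by (intro mult_mono power_mono) auto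
  have A2: "norm ((1 + v) * b / v) \<le> 2 * \<gamma> / norm v"
    unfolding norm_mult norm_divide using p assms by (intro divide_right_mono mult_mono) (auto simp: b_def)
  have "norm (b - b') \<le> \<gamma> + \<gamma>"
    using norm_triangle_ineq4[of b b'] assms by (simp add: b_def b'_def)
  then have A3: "norm ((1 + x) * (b - b')) \<le> (2 * B + 2) * (\<gamma> + \<gamma>)"
    unfolding norm_mult using x1 assms by (intro mult_mono) auto
  also have "\<dots> \<le> (2 * B + 2) * (\<gamma> + \<gamma>) / norm v"
    using v1 assms \<gamma> by (simp add: le_divide_eq mult_left_le)
  finally have A3: "norm ((1 + x) * (b - b')) \<le> (2 * B + 2) * (\<gamma> + \<gamma>) / norm v" .
  have "norm ((1 + v) * x\<^sup>2 - (1 + v) * b / v + (1 + x) * (b - b'))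
    \<le> 2 * \<eta>\<^sup>2 + 2 * \<gamma> / norm v + (2 * B + 2) * (\<gamma> + \<gamma>) / norm v"
    using A1 A2 A3 norm_triangle_ineq[of "(1 + v) * x\<^sup>2 - (1 + v) * b / v" "(1 + x) * (b - b')"]
      norm_triangle_ineq4[of "(1 + v) * x\<^sup>2" "(1 + v) * b / v"] by linarith
  also have "\<dots> = 2 * \<eta>\<^sup>2 + (2 * \<gamma> + (2 * B + 2) * (\<gamma> + \<gamma>)) / norm v"
    by (simp add: add_divide_distrib)
  also have "\<dots> \<le> 2 * \<eta>\<^sup>2 + 8 * (B + 1) * \<gamma> / norm v"
    using \<gamma> assms by (intro add_left_mono divide_right_mono) (auto simp: algebra_simps)
  finally show ?thesis
    unfolding eq norm_mult using assms by (intro mult_mono) auto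
qed

section \<open>Time evolution of the Weyl function on a compact interval\<close>

context
  fixes \<beta> :: "int \<Rightarrow> real \<Rightarrow> real" and B \<kappa> t0 t1 :: real
  assumes bdd: "\<And>n t. t \<in> {t0..t1} \<Longrightarrow> \<bar>\<beta> n t\<bar> \<le> B"
    and deriv: "\<And>n t. t \<in> {t0..t1} \<Longrightarrow>
      (\<beta> n has_real_derivative \<kappa> * (1 - \<beta> n t) * (\<beta> (n + 1) t - \<beta> (n - 1) t)) (at t within {t0..t1})"
    and le: "t0 < t1" and \<kappa>: "\<kappa> > 0"
begin

lemma time_bound_nonneg: "B \<ge> 0"
  using bdd[of t0 0] le by simp

text \<open>One step of the recurrence maps the Riccati equation at \<open>n - 1\<close> to the one at \<open>n\<close> and
  multiplies the defect by the contraction factor.\<close>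

lemma weyl_approx_deriv:
  assumes "0 < norm v" "norm v \<le> radius B" "t \<in> {t0..t1}"
  shows "\<exists>e. ((\<lambda>s. weyl_approx (\<lambda>k. \<beta> k s) m n v) has_vector_derivative
      riccati \<kappa> (\<lambda>k. \<beta> k t) v n (weyl_approx (\<lambda>k. \<beta> k t) m n v) + e) (at t within {t0..t1})
    \<and> norm e \<le> \<kappa> * (8 * (B + 1) * B / norm v) / 2 ^ m"
proof (induction m arbitrary: n)
  case 0
  \<comment> \<open>The starting value 0 is constant in time, so its defect is minus the Riccati
    velocity at 0; the linearisation estimate with \<eta> = 0 and \<gamma> = B bounds it.\<close>
  have "norm (riccati \<kappa> (\<lambda>k. \<beta> k t) v n 0) \<le> \<kappa> * (8 * (B + 1) * B / norm v)"
    using norm_riccati_minus_linear_le[of B \<kappa> v 0 0 "\<lambda>k. \<beta> k t" n B] assms time_bound_nonneg \<kappa> bdd[OF assms(3)]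
    by simp
  then show ?case
    by (intro exI[of _ "- riccati \<kappa> (\<lambda>k. \<beta> k t) v n 0"]) simp
next
  case (Suc m)
  define b where "b = (\<lambda>k. \<beta> k t)"
  define x where "x = weyl_approx b m (n - 1) v"
  have bddb: "\<bar>b k\<bar> \<le> B" for k using bdd[OF assms(3)] by (simp add: b_def)
  have xb: "norm x \<le> 2 * B + 1"
    unfolding x_def by (rule weyl_approx_bounded[of b B, OF bddb assms(2)])
  have ne: "v * x \<noteq> 1"
    by (rule mult_ne_one[OF time_bound_nonneg assms(2) xb])
  obtain e where e: "((\<lambda>s. weyl_approx (\<lambda>k. \<beta> k s) m (n - 1) v) has_vector_derivative
      riccati \<kappa> b v (n - 1) x + e) (at t within {t0..t1})"
    "norm e \<le> \<kappa> * (8 * (B + 1) * B / norm v) / 2 ^ m"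
    using Suc.IH[of "n - 1"] unfolding b_def x_def by blast
  define e' where "e' = (1 - of_real (b (n - 1))) * v / ((1 - v * x) * (1 - v * x)) * e"
  have "norm e' \<le> 1/2 * (\<kappa> * (8 * (B + 1) * B / norm v) / 2 ^ m)"
    unfolding e'_def norm_mult[of _ e]
    by (intro mult_mono weyl_step_contraction_factor[OF time_bound_nonneg assms(2) xb xb bddb] e(2)) auto
  then have 1: "norm e' \<le> \<kappa> * (8 * (B + 1) * B / norm v) / 2 ^ Suc m" by simp
  have "((\<lambda>s. weyl_step (\<beta> (n - 1) s) v (weyl_approx (\<lambda>k. \<beta> k s) m (n - 1) v)) has_vector_derivative
     ((1 - of_real (\<beta> (n - 1) t)) * v * (riccati \<kappa> b v (n - 1) x + e) / (1 - v * x)\<^sup>2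
      - of_real (\<kappa> * (1 - \<beta> (n - 1) t) * (\<beta> (n - 1 + 1) t - \<beta> (n - 1 - 1) t)) / (1 - v * x)))
     (at t within {t0..t1})"
    using has_vector_derivative_weyl_step[OF e(1) deriv[OF assms(3), of "n - 1"], of v] ne
    unfolding x_def b_def by simp
  also have "(1 - of_real (\<beta> (n - 1) t)) * v * (riccati \<kappa> b v (n - 1) x + e) / (1 - v * x)\<^sup>2
      - of_real (\<kappa> * (1 - \<beta> (n - 1) t) * (\<beta> (n - 1 + 1) t - \<beta> (n - 1 - 1) t)) / (1 - v * x)
    = ((1 - of_real (b (n - 1))) * v * riccati \<kappa> b v (n - 1) x / (1 - v * x)\<^sup>2
      - of_real (\<kappa> * (1 - b (n - 1)) * (b n - b (n - 2))) / (1 - v * x)) + e'"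
    by (simp add: b_def e'_def power2_eq_square add_divide_distrib distrib_left mult.assoc)
  also have "\<dots> = riccati \<kappa> b v n (weyl_step (b (n - 1)) v x) + e'"
    using riccati_weyl_step[of v x b n \<kappa>] ne assms(1) by auto
  finally show ?case
    using 1 unfolding b_def x_def by (intro exI[of _ e']) simp
qed

text \<open>Variation of constants: the integrating factor exp (- (t - t0) c) removes the linear
  part, and the mean value inequality bounds the rest. The approximants are differentiated in place
  of \<open>weyl\<close>; their defects vanish as m -> infinity, so the estimate passes to the limit
  without differentiating the limit in t.\<close>

lemma weyl_evolution_approx:
  assumes v: "0 < norm v" "norm v \<le> radius B"
    and \<eta>: "\<And>t. t \<in> {t0..t1} \<Longrightarrow> norm (weyl (\<lambda>k. \<beta> k t) n v) \<le> \<eta>"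
    and \<gamma>: "\<And>t. t \<in> {t0..t1} \<Longrightarrow> \<bar>\<beta> (n - 1) t\<bar> \<le> \<gamma>" "\<And>t. t \<in> {t0..t1} \<Longrightarrow> \<bar>\<beta> n t\<bar> \<le> \<gamma>"
    and c: "c = of_real \<kappa> * (v - 1 / v)"
  shows "norm (exp (- (t1 - t0) *\<^sub>R c) * weyl (\<lambda>k. \<beta> k t1) n v - weyl (\<lambda>k. \<beta> k t0) n v)
    \<le> (t1 - t0) * exp ((t1 - t0) * norm c) * (\<kappa> * (2 * \<eta>\<^sup>2 + 8 * (B + 1) * \<gamma> / norm v))"
proof -
  define x where "x m t = weyl_approx (\<lambda>k. \<beta> k t) m n v" for m t
  define x' where "x' t = weyl (\<lambda>k. \<beta> k t) n v" for t
  define E where "E = \<kappa> * (8 * (B + 1) * B / norm v)"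
  \<comment> \<open>The approximant obeys the bound \<eta> on its limit up to the geometric error of
    \<open>weyl_approx_error\<close>.\<close>
  define \<eta>' where "\<eta>' m = \<eta> + 2 * (2 * B + 1) / 2 ^ m" for m :: nat
  define D where "D m = exp ((t1 - t0) * norm c) * (\<kappa> * (2 * (\<eta>' m)\<^sup>2 + 8 * (B + 1) * \<gamma> / norm v) + E / 2 ^ m)" for m
  have lim: "(\<lambda>m. x m t) \<longlonglongrightarrow> x' t" if "t \<in> {t0..t1}" for t
    unfolding x_def x'_def using bdd[OF that] by (intro weyl_approx_tendsto[of _ B] v) auto
  have bound: "norm (exp (- (t1 - t0) *\<^sub>R c) * x m t1 - x m t0) \<le> (t1 - t0) * D m" for m
  proof -
    define w where "w t = exp (- (t - t0) *\<^sub>R c) * x m t" for t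
    have "\<forall>t\<in>{t0..t1}. \<exists>w'. (w has_vector_derivative w') (at t within {t0..t1}) \<and> norm w' \<le> D m"
    proof
      fix t assume t: "t \<in> {t0..t1}"
      obtain e where e: "(x m has_vector_derivative riccati \<kappa> (\<lambda>k. \<beta> k t) v n (x m t) + e) (at t within {t0..t1})"
        "norm e \<le> E / 2 ^ m"
        using weyl_approx_deriv[OF v t, of m n] unfolding x_def E_def by blast
      have xe: "norm (x m t) \<le> \<eta>' m"
        using \<eta>[OF t] weyl_approx_error[of "\<lambda>k. \<beta> k t" B v m n] bdd[OF t] v
          norm_triangle_ineq[of "x' t" "x m t - x' t"]
        unfolding x_def x'_def \<eta>'_def by simp
      have xb: "norm (x m t) \<le> 2 * B + 1"
        unfolding x_def using bdd[OF t] v by (intro weyl_approx_bounded) auto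
      have "((\<lambda>s. exp (- (s - t0) *\<^sub>R c)) has_vector_derivative (- c) * exp (- (t - t0) *\<^sub>R c)) (at t within {t0..t1})"
        by (rule has_vector_derivative_eq_rhs[OF field_vector_diff_chain_within[unfolded o_def, where g = exp]])
          (auto intro!: derivative_eq_intros)
      from has_vector_derivative_mult[OF this e(1)]
      have "(w has_vector_derivative exp (- (t - t0) *\<^sub>R c) *
         ((riccati \<kappa> (\<lambda>k. \<beta> k t) v n (x m t) - c * x m t) + e)) (at t within {t0..t1})"
        unfolding w_def by (simp add: algebra_simps)
      moreover have "norm (exp (- (t - t0) *\<^sub>R c) *
         ((riccati \<kappa> (\<lambda>k. \<beta> k t) v n (x m t) - c * x m t) + e)) \<le> D m"
        unfolding D_def norm_mult
      proof (intro mult_mono order_trans[OF norm_triangle_ineq] add_mono e(2))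
        have "norm (exp (- (t - t0) *\<^sub>R c)) \<le> exp (norm (- (t - t0) *\<^sub>R c))" by (rule norm_exp)
        also have "\<dots> \<le> exp ((t1 - t0) * norm c)" using t by (auto intro!: mult_right_mono)
        finally show "norm (exp (- (t - t0) *\<^sub>R c)) \<le> exp ((t1 - t0) * norm c)" .
        show "norm (riccati \<kappa> (\<lambda>k. \<beta> k t) v n (x m t) - c * x m t)
           \<le> \<kappa> * (2 * (\<eta>' m)\<^sup>2 + 8 * (B + 1) * \<gamma> / norm v)"
          unfolding c using time_bound_nonneg \<kappa> v xb xe \<gamma>[OF t]
          by (intro norm_riccati_minus_linear_le) auto
      qed auto
      ultimately show "\<exists>w'. (w has_vector_derivative w') (at t within {t0..t1}) \<and> norm w' \<le> D m" by blast
    qed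
    then obtain w' where w': "\<And>t. t \<in> {t0..t1} \<Longrightarrow> (w has_vector_derivative w' t) (at t within {t0..t1})"
      "\<And>t. t \<in> {t0..t1} \<Longrightarrow> norm (w' t) \<le> D m"
      by metis
    have "norm (w t1 - w t0) \<le> D m * t1 - D m * t0"
    proof (rule differentiable_bound_general[OF le, of _ _ w'])
      show "continuous_on {t0..t1} w"
        using w'(1) by (meson continuous_on_eq_continuous_within has_vector_derivative_continuous)
      show "(w has_vector_derivative w' t) (at t)" if "t0 < t" "t < t1" for t
        using w'(1)[of t] that at_within_Icc_at[OF that] by simp
      show "norm (w' t) \<le> D m" if "t0 < t" "t < t1" for t
        using w'(2)[of t] that by simp
    qed (auto intro!: continuous_intros derivative_eq_intros)
    then show ?thesis unfolding w_def by (simp add: algebra_simps)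
  qed
  have "(\<lambda>m. norm (exp (- (t1 - t0) *\<^sub>R c) * x m t1 - x m t0)) \<longlonglongrightarrow> norm (exp (- (t1 - t0) *\<^sub>R c) * x' t1 - x' t0)"
    using le by (intro tendsto_intros lim) auto
  moreover have "(\<lambda>m. (t1 - t0) * D m) \<longlonglongrightarrow> (t1 - t0) * (exp ((t1 - t0) * norm c) *
      (\<kappa> * (2 * (\<eta> + 0)\<^sup>2 + 8 * (B + 1) * \<gamma> / norm v) + 0))"
  proof -
    have "(\<lambda>m. E / 2 ^ m) \<longlonglongrightarrow> 0" by real_asymp
    moreover have "(\<lambda>m. 2 * (2 * B + 1) / 2 ^ m) \<longlonglongrightarrow> 0" by real_asymp
    ultimately show ?thesis
      unfolding D_def \<eta>'_def by (intro tendsto_intros)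
  qed
  ultimately have "norm (exp (- (t1 - t0) *\<^sub>R c) * x' t1 - x' t0) \<le> (t1 - t0) * (exp ((t1 - t0) * norm c) *
      (\<kappa> * (2 * (\<eta> + 0)\<^sup>2 + 8 * (B + 1) * \<gamma> / norm v) + 0))"
    using bound LIMSEQ_le by blast
  then show ?thesis unfolding x'_def by (simp only: add_0_right mult.assoc)
qed

end

section \<open>The scattering function\<close>

lemma discrete_gronwall:
  fixes x a g :: "nat \<Rightarrow> real"
  assumes step: "\<And>k. k < n \<Longrightarrow> x (Suc k) \<le> (1 + a k) * (x k + g k)"
    and nonneg: "\<And>k. a k \<ge> 0" "\<And>k. g k \<ge> 0" "x 0 \<ge> 0"
  shows "x n \<le> exp (\<Sum>k<n. a k) * (x 0 + (\<Sum>k<n. g k))"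
  using step
proof (induction n)
  case (Suc n)
  define A G where "A = (\<Sum>k<n. a k)" and "G = (\<Sum>k<n. g k)"
  have A: "A \<ge> 0" unfolding A_def by (intro sum_nonneg nonneg)
  have G: "G \<ge> 0" unfolding G_def by (intro sum_nonneg nonneg)
  have "1 * g n \<le> exp A * g n"
    using A nonneg by (intro mult_right_mono) auto
  moreover have "x n \<le> exp A * (x 0 + G)"
    using Suc unfolding A_def G_def by simp
  ultimately have "x n + g n \<le> exp A * (x 0 + G + g n)"
    by (simp add: distrib_left)
  then have "(1 + a n) * (x n + g n) \<le> (1 + a n) * (exp A * (x 0 + G + g n))"
    using nonneg(1)[of n] by (intro mult_left_mono) auto
  also have "\<dots> \<le> exp (a n) * (exp A * (x 0 + G + g n))"
    using exp_ge_add_one_self[of "a n"] G nonneg by (intro mult_right_mono) auto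
  also have "\<dots> = exp (\<Sum>k<Suc n. a k) * (x 0 + (\<Sum>k<Suc n. g k))"
    by (simp add: A_def G_def exp_add algebra_simps)
  finally show ?case
    using Suc.prems[of n] by simp
qed simp

text \<open>To first order a free step multiplies the value by v; dividing by v^n compensates this,
  so that a limit as n -> infinity can exist.\<close>

definition scaled_weyl :: "(int \<Rightarrow> real) \<Rightarrow> nat \<Rightarrow> complex \<Rightarrow> complex" where
  "scaled_weyl \<beta> n v = weyl \<beta> (int n) v / v ^ n"

definition scattering :: "(int \<Rightarrow> real) \<Rightarrow> complex \<Rightarrow> complex" where
  "scattering \<beta> v = lim (\<lambda>n. scaled_weyl \<beta> n v)"

context
  fixes \<beta> :: "int \<Rightarrow> real" and B :: real
  assumes bdd: "\<And>n. \<bar>\<beta> n\<bar> \<le> B"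
begin

lemma norm_weyl_Suc_le:
  assumes "norm v \<le> radius B"
  shows "norm (weyl \<beta> (n + 1) v) \<le> norm (weyl \<beta> n v) / 2 + 2 * \<bar>\<beta> n\<bar>"
proof -
  have B: "B \<ge> 0" using bound_nonneg[of \<beta> B, OF bdd] .
  have "norm v * norm (weyl \<beta> n v) \<le> 1/8 * norm (weyl \<beta> n v)"
    using assms radius_le[OF B] by (intro mult_right_mono) auto
  moreover have "norm (weyl \<beta> (n + 1) v) \<le> 4/3 * (norm v * norm (weyl \<beta> n v) + \<bar>\<beta> n\<bar>)"
    using norm_weyl_step_le[OF norm_mult_le_quarter[OF B assms weyl_bounded[of \<beta> B, OF bdd assms]], of "\<beta> n" n]
    unfolding weyl_recurrence[of \<beta> B, OF bdd assms] norm_mult .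
  ultimately show ?thesis
    using norm_ge_zero[of "weyl \<beta> n v"] abs_ge_zero[of "\<beta> n"] by argo
qed

lemma sum_norm_weyl_le:
  assumes "norm v \<le> radius B"
  shows "(\<Sum>k<n. norm (weyl \<beta> (int k) v)) \<le> 2 * (2 * B + 1) + 4 * (\<Sum>k<n. \<bar>\<beta> (int k)\<bar>)"
proof -
  \<comment> \<open>Twice the boundary term is added on the left: each value is at most half its
    predecessor plus 2 |\<beta>|, and with this reserve the induction closes.\<close>
  have "(\<Sum>k<n. norm (weyl \<beta> (int k) v)) + 2 * norm (weyl \<beta> (int n) v)
    \<le> 2 * (2 * B + 1) + 4 * (\<Sum>k<n. \<bar>\<beta> (int k)\<bar>)"
  proof (induction n)
    case 0
    show ?case using weyl_bounded[of \<beta> B, OF bdd assms, of 0] by simp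
  next
    case (Suc n)
    then show ?case
      using norm_weyl_Suc_le[OF assms, of "int n"] by (simp add: add.commute)
  qed
  then show ?thesis using norm_ge_zero[of "weyl \<beta> (int n) v"] by linarith
qed

lemma scaled_weyl_Suc:
  assumes "v \<noteq> 0" "norm v \<le> radius B"
  shows "scaled_weyl \<beta> (Suc n) v =
    (scaled_weyl \<beta> n v - of_real (\<beta> (int n)) / v ^ Suc n) / (1 - v * weyl \<beta> (int n) v)"
proof -
  have d: "1 - v * weyl \<beta> (int n) v \<noteq> 0"
    using mult_ne_one[OF bound_nonneg[of \<beta> B, OF bdd] assms(2) weyl_bounded[of \<beta> B, OF bdd assms(2)]] by auto
  have "(v * x - b) / d / v ^ Suc n = (x / v ^ n - b / v ^ Suc n) / d" if "d \<noteq> 0" for x b d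
    using that assms(1) by (simp add: field_simps)
  from this[OF d] show ?thesis
    using weyl_recurrence[of \<beta> B, OF bdd assms(2), of "int n"]
    by (simp add: scaled_weyl_def weyl_step_def add.commute)
qed

text \<open>The amplification is written as 1 + |weyl| because \<open>sum_norm_weyl_le\<close>
  controls the sum of |weyl|; by Gronwall the product of these factors then stays bounded as long as
  the sums of |\<beta>| do.\<close>

lemma norm_scaled_weyl_Suc_le:
  assumes "v \<noteq> 0" "norm v \<le> radius B"
  shows "norm (scaled_weyl \<beta> (Suc n) v) \<le>
    (1 + norm (weyl \<beta> (int n) v)) * (norm (scaled_weyl \<beta> n v) + \<bar>\<beta> (int n)\<bar> / norm v ^ Suc n)"
proof -
  define x where "x = weyl \<beta> (int n) v"
  have B: "B \<ge> 0" using bound_nonneg[of \<beta> B, OF bdd] .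
  have q: "norm (v * x) \<le> 1/4"
    unfolding x_def by (intro norm_mult_le_quarter[OF B assms(2)] weyl_bounded[of \<beta> B, OF bdd assms(2)])
  have "norm (v * x) \<le> 1/8 * norm x"
    unfolding norm_mult using assms radius_le[OF B] by (intro mult_right_mono) auto
  then have "2 * norm (v * x) \<le> norm x" using norm_ge_zero[of x] by linarith
  \<comment> \<open>The product is 1 + y (1 - 2 y) with y \<le> 1/4.\<close>
  moreover have "(1 + 2 * norm (v * x)) * (1 - norm (v * x)) \<ge> 1"
  proof -
    have "(1 + 2 * y) * (1 - y) \<ge> 1" if "0 \<le> y" "y \<le> 1/4" for y :: real
      using mult_left_mono[OF that(2,1)] that(1) by (simp add: algebra_simps)
    from this[OF norm_ge_zero q] show ?thesis .
  qed
  ultimately have "(1 + norm x) * (1 - norm (v * x)) \<ge> 1"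
    using q mult_right_mono[of "1 + 2 * norm (v * x)" "1 + norm x" "1 - norm (v * x)"] by linarith
  moreover have "norm (1 - v * x) \<ge> 1 - norm (v * x)" by (rule norm_one_minus_ge) simp
  then have "(1 + norm x) * norm (1 - v * x) \<ge> (1 + norm x) * (1 - norm (v * x))"
    by (intro mult_left_mono) auto
  ultimately have d: "(1 + norm x) * norm (1 - v * x) \<ge> 1" by linarith
  have "norm (1 - v * x) > 0" using q norm_one_minus_ge[of "v * x" "1/4"] by linarith
  with d have inv: "1 / norm (1 - v * x) \<le> 1 + norm x" by (simp add: field_simps)
  have "norm (scaled_weyl \<beta> n v - of_real (\<beta> (int n)) / v ^ Suc n)
    \<le> norm (scaled_weyl \<beta> n v) + \<bar>\<beta> (int n)\<bar> / norm v ^ Suc n"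
    by (rule order_trans[OF norm_triangle_ineq4]) (simp add: norm_divide norm_mult norm_power)
  then have "norm (scaled_weyl \<beta> (Suc n) v) \<le>
    (norm (scaled_weyl \<beta> n v) + \<bar>\<beta> (int n)\<bar> / norm v ^ Suc n) * (1 / norm (1 - v * x))"
    unfolding scaled_weyl_Suc[OF assms] x_def[symmetric] norm_divide
    by (simp add: divide_right_mono)
  also have "\<dots> \<le> (norm (scaled_weyl \<beta> n v) + \<bar>\<beta> (int n)\<bar> / norm v ^ Suc n) * (1 + norm x)"
    using inv by (intro mult_left_mono) auto
  finally show ?thesis by (simp add: x_def mult.commute)
qed

lemma norm_scaled_weyl_le:
  assumes "v \<noteq> 0" "norm v \<le> radius B" "(\<Sum>k<n. \<bar>\<beta> (int k)\<bar>) \<le> S"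
  shows "norm (scaled_weyl \<beta> n v) \<le>
    exp (2 * (2 * B + 1) + 4 * S) * (2 * B + 1 + (\<Sum>k<n. \<bar>\<beta> (int k)\<bar> / norm v ^ Suc k))"
proof -
  have G: "(\<Sum>k<n. \<bar>\<beta> (int k)\<bar> / norm v ^ Suc k) \<ge> 0" by (intro sum_nonneg) auto
  have "norm (scaled_weyl \<beta> n v) \<le> exp (\<Sum>k<n. norm (weyl \<beta> (int k) v)) *
      (norm (scaled_weyl \<beta> 0 v) + (\<Sum>k<n. \<bar>\<beta> (int k)\<bar> / norm v ^ Suc k))"
    using assms by (intro discrete_gronwall norm_scaled_weyl_Suc_le) auto
  also have "\<dots> \<le> exp (2 * (2 * B + 1) + 4 * S) * (2 * B + 1 + (\<Sum>k<n. \<bar>\<beta> (int k)\<bar> / norm v ^ Suc k))"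
    using sum_norm_weyl_le[OF assms(2), of n] assms(3) weyl_bounded[of \<beta> B, OF bdd assms(2), of 0] G
    by (intro mult_mono add_mono) (auto simp: scaled_weyl_def)
  finally show ?thesis .
qed

end

text \<open>Tailored so that the sum of |\<beta> k| / r^(k + 1) is at most a constant times exp
  (\<epsilon> / r) for each \<epsilon> > 0, that is, of minimal exponential type in 1 / r. Only the
  nonnegative sites are constrained.\<close>

definition factorial_decay :: "(int \<Rightarrow> real) \<Rightarrow> bool" where
  "factorial_decay \<beta> \<longleftrightarrow> (\<forall>\<epsilon>>0. \<exists>K. \<forall>n. \<bar>\<beta> (int n)\<bar> \<le> K * \<epsilon> ^ n / fact n)"

lemma factorial_decayE:
  assumes "factorial_decay \<beta>" "\<epsilon> > 0"
  obtains K where "K \<ge> 0" "\<And>n. \<bar>\<beta> (int n)\<bar> \<le> K * \<epsilon> ^ n / fact n"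
proof -
  obtain K where K: "\<And>n. \<bar>\<beta> (int n)\<bar> \<le> K * \<epsilon> ^ n / fact n"
    using assms unfolding factorial_decay_def by blast
  moreover have "K \<ge> 0" using order_trans[OF abs_ge_zero K[of 0]] by simp
  ultimately show ?thesis using that by blast
qed

lemma sum_power_div_fact_le_exp:
  fixes x :: real
  assumes "x \<ge> 0"
  shows "(\<Sum>k<n. x ^ k / fact k) \<le> exp x"
proof -
  have "(\<Sum>k<n. inverse (fact k) *\<^sub>R x ^ k) \<le> exp x"
    unfolding exp_def using assms summable_exp_generic[of x] by (intro sum_le_suminf) auto
  then show ?thesis by (simp add: field_simps)
qed

lemma factorial_decay_sum_le:
  assumes "factorial_decay \<beta>" "\<epsilon> > 0"
  obtains C where "C \<ge> 0" "\<And>n r. r > 0 \<Longrightarrow> (\<Sum>k<n. \<bar>\<beta> (int k)\<bar> / r ^ Suc k) \<le> C * exp (\<epsilon> / r)"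
proof -
  \<comment> \<open>Half of \<epsilon> is kept in reserve: the stray factor 1 / r is absorbed by
    means of \<epsilon> / (2 r) \<le> exp (\<epsilon> / (2 r)).\<close>
  obtain K where K: "K \<ge> 0" "\<And>n. \<bar>\<beta> (int n)\<bar> \<le> K * (\<epsilon>/2) ^ n / fact n"
    using factorial_decayE[OF assms(1), of "\<epsilon>/2"] assms(2) by auto
  have "(\<Sum>k<n. \<bar>\<beta> (int k)\<bar> / r ^ Suc k) \<le> (2 * K / \<epsilon>) * exp (\<epsilon> / r)" if r: "r > 0" for n and r :: real
  proof -
    have "(\<Sum>k<n. \<bar>\<beta> (int k)\<bar> / r ^ Suc k) \<le> (\<Sum>k<n. K / r * ((\<epsilon> / 2 / r) ^ k / fact k))"
    proof (rule sum_mono)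
      fix k
      have "\<bar>\<beta> (int k)\<bar> / r ^ Suc k \<le> (K * (\<epsilon>/2) ^ k / fact k) / r ^ Suc k"
        using r K(2) by (intro divide_right_mono) auto
      then show "\<bar>\<beta> (int k)\<bar> / r ^ Suc k \<le> K / r * ((\<epsilon> / 2 / r) ^ k / fact k)"
        by (simp add: power_divide field_simps)
    qed
    also have "\<dots> = K / r * (\<Sum>k<n. (\<epsilon> / 2 / r) ^ k / fact k)"
      by (simp add: sum_distrib_left)
    also have "\<dots> \<le> K / r * exp (\<epsilon> / 2 / r)"
      using K(1) r assms(2) by (intro mult_left_mono sum_power_div_fact_le_exp) auto
    also have "\<dots> = (2 * K / \<epsilon>) * ((\<epsilon> / 2 / r) * exp (\<epsilon> / 2 / r))"
      using assms(2) by (simp add: field_simps)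
    also have "\<dots> \<le> (2 * K / \<epsilon>) * (exp (\<epsilon> / 2 / r) * exp (\<epsilon> / 2 / r))"
      using K(1) assms(2) order_trans[OF _ exp_ge_add_one_self[of "\<epsilon> / 2 / r"], of "\<epsilon> / 2 / r"]
      by (intro mult_left_mono mult_right_mono) auto
    also have "exp (\<epsilon> / 2 / r) * exp (\<epsilon> / 2 / r) = exp (\<epsilon> / r)"
      by (simp flip: exp_add)
    finally show ?thesis .
  qed
  then show ?thesis using that[of "2 * K / \<epsilon>"] K(1) assms(2) by auto
qed

section \<open>Convergence to the scattering function, its growth and holomorphy\<close>

context
  fixes \<beta> :: "int \<Rightarrow> real" and B :: real
  assumes bdd: "\<And>n. \<bar>\<beta> n\<bar> \<le> B" and decay: "factorial_decay \<beta>"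
begin

lemma norm_scaled_weyl_growth:
  assumes "\<epsilon> > 0"
  obtains C where "C \<ge> 0"
    "\<And>n v. v \<noteq> 0 \<Longrightarrow> norm v \<le> radius B \<Longrightarrow> norm (scaled_weyl \<beta> n v) \<le> C * exp (\<epsilon> / norm v)"
proof -
  have B: "B \<ge> 0" using bound_nonneg[of \<beta> B, OF bdd] .
  \<comment> \<open>At r = 1 this bounds the sum of |\<beta>| itself, which enters only the constant
    E; the second application carries the growth in 1 / |v|.\<close>
  obtain C1 where C1: "C1 \<ge> 0" "\<And>n r. r > 0 \<Longrightarrow> (\<Sum>k<n. \<bar>\<beta> (int k)\<bar> / r ^ Suc k) \<le> C1 * exp (1 / r)"
    using factorial_decay_sum_le[OF decay zero_less_one] by blast
  from C1(2)[of 1] have S: "(\<Sum>k<n. \<bar>\<beta> (int k)\<bar>) \<le> C1 * exp 1" for n by simp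
  obtain C2 where C2: "C2 \<ge> 0" "\<And>n r. r > 0 \<Longrightarrow> (\<Sum>k<n. \<bar>\<beta> (int k)\<bar> / r ^ Suc k) \<le> C2 * exp (\<epsilon> / r)"
    using factorial_decay_sum_le[OF decay assms] by blast
  define E where "E = exp (2 * (2 * B + 1) + 4 * (C1 * exp 1))"
  have "norm (scaled_weyl \<beta> n v) \<le> E * (2 * B + 1 + C2) * exp (\<epsilon> / norm v)"
    if v: "v \<noteq> 0" "norm v \<le> radius B" for n v
  proof -
    have "norm (scaled_weyl \<beta> n v) \<le> E * (2 * B + 1 + (\<Sum>k<n. \<bar>\<beta> (int k)\<bar> / norm v ^ Suc k))"
      unfolding E_def by (rule norm_scaled_weyl_le[of \<beta> B, OF bdd v S])
    also have "\<dots> \<le> E * ((2 * B + 1) * exp (\<epsilon> / norm v) + C2 * exp (\<epsilon> / norm v))"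
    proof (intro mult_left_mono add_mono)
      have "(2 * B + 1) * 1 \<le> (2 * B + 1) * exp (\<epsilon> / norm v)"
        using B assms by (intro mult_left_mono) auto
      then show "2 * B + 1 \<le> (2 * B + 1) * exp (\<epsilon> / norm v)" by simp
      show "(\<Sum>k<n. \<bar>\<beta> (int k)\<bar> / norm v ^ Suc k) \<le> C2 * exp (\<epsilon> / norm v)"
        using C2(2)[of "norm v" n] v(1) by simp
    qed (simp add: E_def)
    finally show ?thesis by (simp add: algebra_simps)
  qed
  moreover have "E * (2 * B + 1 + C2) \<ge> 0" using B C2 by (simp add: E_def)
  ultimately show ?thesis using that by blast
qed

text \<open>Weierstrass M-test for the increments. With x = v^n z an increment is (v x z - \<beta> n
  / v^(n + 1)) / (1 - v x); on the annulus z is bounded by M, so the first term is geometric and the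
  second is dominated by an exponential series.\<close>

lemma scaled_weyl_uniform_limit:
  assumes "\<eta> > 0"
  shows "uniform_limit {v. \<eta> \<le> norm v \<and> norm v \<le> radius B} (scaled_weyl \<beta>) (scattering \<beta>) sequentially"
proof -
  let ?A = "{v. \<eta> \<le> norm v \<and> norm v \<le> radius B}"
  have B: "B \<ge> 0" using bound_nonneg[of \<beta> B, OF bdd] .
  obtain C where C: "C \<ge> 0"
    "\<And>n v. v \<noteq> 0 \<Longrightarrow> norm v \<le> radius B \<Longrightarrow> norm (scaled_weyl \<beta> n v) \<le> C * exp (1 / norm v)"
    using norm_scaled_weyl_growth[OF zero_less_one] by blast
  define M where "M = C * exp (1 / \<eta>)"
  have M: "norm (scaled_weyl \<beta> n v) \<le> M" if "v \<in> ?A" for n v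
  proof -
    have pos: "norm v > 0" using that assms by (simp only: mem_Collect_eq) linarith
    then have "norm (scaled_weyl \<beta> n v) \<le> C * exp (1 / norm v)" using C(2)[of v n] that by auto
    also have "\<dots> \<le> M" unfolding M_def using C(1) that assms pos
      by (intro mult_left_mono) (auto intro!: divide_left_mono)
    finally show ?thesis .
  qed
  obtain K where K: "K \<ge> 0" "\<And>n. \<bar>\<beta> (int n)\<bar> \<le> K * 1 ^ n / fact n"
    using factorial_decayE[OF decay zero_less_one] by blast
  define m where "m n = (M\<^sup>2 * (1/8) ^ n + K / \<eta> * (inverse (fact n) *\<^sub>R (1 / \<eta>) ^ n)) / (3/4)" for n :: nat
  define f where "f n v = scaled_weyl \<beta> (Suc n) v - scaled_weyl \<beta> n v" for n v
  have "norm (f n v) \<le> m n" if v: "v \<in> ?A" for n v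
  proof -
    define x where "x = weyl \<beta> (int n) v"
    define z where "z = scaled_weyl \<beta> n v"
    have v': "v \<noteq> 0" "norm v \<le> radius B" "norm v \<le> 1/8" using v assms radius_le[OF B] by auto
    have xz: "x = v ^ n * z" using v' by (simp add: x_def z_def scaled_weyl_def)
    have q: "norm (v * x) \<le> 1/4"
      unfolding x_def by (intro norm_mult_le_quarter[OF B v'(2)] weyl_bounded[of \<beta> B, OF bdd v'(2)])
    then have ne: "1 - v * x \<noteq> 0" by auto
    have "f n v = (v * x * z - of_real (\<beta> (int n)) / v ^ Suc n) / (1 - v * x)"
      unfolding f_def scaled_weyl_Suc[of \<beta> B, OF bdd v'(1,2)] using ne v'(1)
      unfolding x_def[symmetric] z_def[symmetric] by (simp add: divide_simps) (simp add: algebra_simps)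
    also have "norm \<dots> \<le> (M\<^sup>2 * (1/8) ^ n + K / \<eta> * (inverse (fact n) *\<^sub>R (1 / \<eta>) ^ n)) / (3/4)"
      unfolding norm_divide
    proof (intro frac_le order_trans[OF norm_triangle_ineq4] add_mono)
      have zM: "norm z \<le> M" unfolding z_def using M v by blast
      have "norm (v * x * z) = norm v * norm v ^ n * (norm z * norm z)"
        by (simp add: xz norm_mult norm_power mult_ac)
      also have "\<dots> \<le> 1 * (1/8) ^ n * (M * M)"
        using v' zM order_trans[OF norm_ge_zero zM] by (intro mult_mono power_mono) auto
      finally show "norm (v * x * z) \<le> M\<^sup>2 * (1/8) ^ n" by (simp add: power2_eq_square mult_ac)
      have "norm (of_real (\<beta> (int n)) / v ^ Suc n) = \<bar>\<beta> (int n)\<bar> / norm v ^ Suc n"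
        by (simp add: norm_divide norm_mult norm_power)
      also have "\<dots> \<le> (K * 1 ^ n / fact n) / \<eta> ^ Suc n"
        using K assms v by (intro frac_le power_mono K) auto
      finally show "norm (of_real (\<beta> (int n)) / v ^ Suc n) \<le> K / \<eta> * (inverse (fact n) *\<^sub>R (1 / \<eta>) ^ n)"
        by (simp add: power_one_over field_simps)
      show "3/4 \<le> norm (1 - v * x)" using norm_one_minus_ge[OF q] by simp
      have "0 \<le> K" by (rule K)
      then show "0 \<le> M\<^sup>2 * (1/8) ^ n + K / \<eta> * (inverse (fact n) *\<^sub>R (1 / \<eta>) ^ n)"
        using assms by simp
    qed auto
    finally show ?thesis unfolding m_def .
  qed
  moreover have "summable m"
    unfolding m_def by (intro summable_divide summable_mult summable_add summable_geometric summable_exp_generic) auto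
  ultimately have "uniform_limit ?A (\<lambda>n x. \<Sum>i<n. f i x) (\<lambda>x. \<Sum>i. f i x) sequentially"
    by (rule Weierstrass_m_test)
  then have "uniform_limit ?A (\<lambda>n x. scaled_weyl \<beta> 0 x + (\<Sum>i<n. f i x)) (\<lambda>x. scaled_weyl \<beta> 0 x + (\<Sum>i. f i x)) sequentially"
    by (intro uniform_limit_intros)
  moreover have "scaled_weyl \<beta> 0 x + (\<Sum>i<n. f i x) = scaled_weyl \<beta> n x" for n x
    unfolding f_def using sum_lessThan_telescope[of "\<lambda>i. scaled_weyl \<beta> i x" n] by simp
  ultimately have "uniform_limit ?A (scaled_weyl \<beta>) (\<lambda>x. scaled_weyl \<beta> 0 x + (\<Sum>i. f i x)) sequentially"
    by (simp add: fun_eq_iff)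
  then have "uniformly_convergent_on ?A (scaled_weyl \<beta>)"
    by (rule uniformly_convergentI)
  moreover have "scattering \<beta> = (\<lambda>v. lim (\<lambda>n. scaled_weyl \<beta> n v))"
    by (simp add: scattering_def fun_eq_iff)
  ultimately show ?thesis
    using uniformly_convergent_uniform_limit_iff by metis
qed

lemma scaled_weyl_tendsto:
  assumes "v \<noteq> 0" "norm v \<le> radius B"
  shows "(\<lambda>n. scaled_weyl \<beta> n v) \<longlonglongrightarrow> scattering \<beta> v"
  using tendsto_uniform_limitI[OF scaled_weyl_uniform_limit[of "norm v"], of v] assms by auto

lemma scattering_growth:
  assumes "\<epsilon> > 0"
  obtains C where
    "\<And>v. v \<noteq> 0 \<Longrightarrow> norm v \<le> radius B \<Longrightarrow> norm (scattering \<beta> v) \<le> C * exp (\<epsilon> / norm v)"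
proof -
  obtain C where C: "C \<ge> 0"
    "\<And>n v. v \<noteq> 0 \<Longrightarrow> norm v \<le> radius B \<Longrightarrow> norm (scaled_weyl \<beta> n v) \<le> C * exp (\<epsilon> / norm v)"
    using norm_scaled_weyl_growth[OF assms] by blast
  have "norm (scattering \<beta> v) \<le> C * exp (\<epsilon> / norm v)" if v: "v \<noteq> 0" "norm v \<le> radius B" for v
    using LIMSEQ_le_const2[OF tendsto_norm[OF scaled_weyl_tendsto[OF v]]] C(2)[OF v] by blast
  then show ?thesis by (rule that)
qed

lemma scattering_holomorphic: "scattering \<beta> holomorphic_on ball 0 (radius B) - {0}"
proof (rule holomorphic_uniform_sequence[where f = "scaled_weyl \<beta>"])
  show "scaled_weyl \<beta> n holomorphic_on ball 0 (radius B) - {0}" for n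
    unfolding scaled_weyl_def
    by (intro holomorphic_intros holomorphic_on_subset[OF weyl_holomorphic[of \<beta> B, OF bdd]]) auto
next
  fix v :: complex assume "v \<in> ball 0 (radius B) - {0}"
  moreover have "open (ball 0 (radius B) - {0 :: complex})" by auto
  ultimately obtain d where d: "d > 0" "cball v d \<subseteq> ball 0 (radius B) - {0}"
    using open_contains_cball by blast
  have "norm v > d" using d(2)[THEN subsetD, of 0] by (auto simp: not_le[symmetric])
  have "norm v - d \<le> norm z \<and> norm z \<le> radius B" if "z \<in> cball v d" for z
    using d(2) that norm_triangle_ineq2[of v z] by (force simp: dist_norm)
  then have "cball v d \<subseteq> {z. norm v - d \<le> norm z \<and> norm z \<le> radius B}" by blast
  then have "uniform_limit (cball v d) (scaled_weyl \<beta>) (scattering \<beta>) sequentially"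
    using uniform_limit_on_subset[OF scaled_weyl_uniform_limit[of "norm v - d"]] \<open>norm v > d\<close> by auto
  with d show "\<exists>d>0. cball v d \<subseteq> ball 0 (radius B) - {0} \<and>
      uniform_limit (cball v d) (scaled_weyl \<beta>) (scattering \<beta>) sequentially" by blast
qed auto

end

section \<open>Functions of minimal type\<close>

text \<open>Once the product Q over the four rotations is known to vanish, each point of a circle
  is, up to a rotation by a power of i, a zero of g. A nonconstant holomorphic g has only finitely
  many zeros there, and a constant nonzero g has none.\<close>

lemma minimal_type_vanishing:
  fixes f g :: "complex \<Rightarrow> complex"
  assumes r: "r > 0" and c: "c > 0" and hol: "g holomorphic_on ball 0 r - {0}"
    and rel: "\<And>v. v \<noteq> 0 \<Longrightarrow> norm v < r \<Longrightarrow> norm (g v) = norm (f v) * exp (c * Re (v - 1 / v))"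
    and growth_f: "\<And>\<epsilon>. \<epsilon> > 0 \<Longrightarrow> \<exists>C. \<forall>v. v \<noteq> 0 \<longrightarrow> norm v < r \<longrightarrow> norm (f v) \<le> C * exp (\<epsilon> / norm v)"
    and growth_g: "\<And>\<epsilon>. \<epsilon> > 0 \<Longrightarrow> \<exists>C. \<forall>v. v \<noteq> 0 \<longrightarrow> norm v < r \<longrightarrow> norm (g v) \<le> C * exp (\<epsilon> / norm v)"
    and v: "v \<noteq> 0" "norm v < r"
  shows "g v = 0"
proof (rule ccontr)
  assume gv: "g v \<noteq> 0"
  let ?S = "ball 0 r - {0 :: complex}"
  \<comment> \<open>Four factors, each growing like exp (c / (8 |v|)), cost c / (2 |v|) in the
    exponent, half of the gain c / |v| from the relation between f and g.\<close>
  have "c / 8 > 0" using c by simp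
  from growth_f[OF this] obtain Cf where
    Cf: "\<And>v. v \<noteq> 0 \<Longrightarrow> norm v < r \<Longrightarrow> norm (f v) \<le> Cf * exp (c / 8 / norm v)" by blast
  from growth_g[OF \<open>c / 8 > 0\<close>] obtain Cg where
    Cg: "\<And>v. v \<noteq> 0 \<Longrightarrow> norm v < r \<Longrightarrow> norm (g v) \<le> Cg * exp (c / 8 / norm v)" by blast
  define C where "C = max (max Cg (Cf * exp (c * r))) 0"
  have C0: "C \<ge> 0" by (simp add: C_def)
  \<comment> \<open>The relation to f is used where Re (1 / v) \<ge> 0, the bare growth of g
    elsewhere.\<close>
  have bound: "norm (g v) \<le> C * exp (c / 8 / norm v - c * max 0 (Re (1 / v)))"
    if v: "v \<noteq> 0" "norm v < r" for v
  proof (cases "Re (1 / v) \<ge> 0")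
    case False
    have "norm (g v) \<le> Cg * exp (c / 8 / norm v)" by (rule Cg[OF v])
    also have "\<dots> \<le> C * exp (c / 8 / norm v)" by (intro mult_right_mono) (auto simp: C_def)
    finally show ?thesis using False by (simp add: max_def)
  next
    case True
    have "norm (g v) \<le> Cf * exp (c / 8 / norm v) * exp (c * Re (v - 1 / v))"
      unfolding rel[OF v] by (intro mult_right_mono Cf v) auto
    also have "\<dots> = Cf * exp (c * Re v) * exp (c / 8 / norm v - c * Re (1 / v))"
      by (simp add: algebra_simps flip: exp_add)
    also have "\<dots> \<le> C * exp (c / 8 / norm v - c * Re (1 / v))"
    proof (intro mult_right_mono)
      have "Cf \<ge> 0" using order_trans[OF norm_ge_zero Cf[OF v]] by (simp add: zero_le_mult_iff)
      moreover have "exp (c * Re v) \<le> exp (c * r)"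
        using c abs_Re_le_cmod[of v] v(2) by auto
      ultimately have "Cf * exp (c * Re v) \<le> Cf * exp (c * r)" by (intro mult_left_mono)
      then show "Cf * exp (c * Re v) \<le> C" unfolding C_def by linarith
    qed auto
    finally show ?thesis using True by (simp add: max_def)
  qed
  \<comment> \<open>The factors at v and - v jointly contribute the decay c |Re (1 / v)|, those at i
    v and - i v contribute c |Im (1 / v)|, and the two add up to at least c / |v|.\<close>
  define Q where "Q v = (if v = 0 then 0 else g v * g (- v) * (g (\<i> * v) * g (- (\<i> * v))))" for v
  have Qb: "norm (Q v) \<le> C ^ 4 * exp (- (c / 2) / norm v)" if v: "v \<noteq> 0" "norm v < r" for v
  proof -
    define x y where "x = Re (1 / v)" and "y = Im (1 / v)"
    have iv: "1 / (\<i> * v) = - (\<i> * (1 / v))" using v by (simp add: field_simps)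
    have re: "Re (1 / (\<i> * v)) = y" "Re (1 / - (\<i> * v)) = - y"
      unfolding divide_minus_right iv y_def by (simp_all only: uminus_complex.sel Re_i_times minus_minus)
    have b1: "norm (g v) \<le> C * exp (c / 8 / norm v - c * max 0 x)"
      using bound[OF v] by (simp add: x_def)
    have b2: "norm (g (- v)) \<le> C * exp (c / 8 / norm v - c * max 0 (- x))"
      using bound[of "- v"] v by (simp add: x_def)
    have b3: "norm (g (\<i> * v)) \<le> C * exp (c / 8 / norm v - c * max 0 y)"
      using bound[of "\<i> * v", unfolded re] v by (simp add: norm_mult)
    have b4: "norm (g (- (\<i> * v))) \<le> C * exp (c / 8 / norm v - c * max 0 (- y))"
      using bound[of "- (\<i> * v)", unfolded re] v by (simp add: norm_mult)
    have "norm (Q v) = norm (g v) * norm (g (- v)) * (norm (g (\<i> * v)) * norm (g (- (\<i> * v))))"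
      using v by (simp add: Q_def norm_mult)
    also have "\<dots> \<le> (C * exp (c / 8 / norm v - c * max 0 x)) * (C * exp (c / 8 / norm v - c * max 0 (- x))) *
        ((C * exp (c / 8 / norm v - c * max 0 y)) * (C * exp (c / 8 / norm v - c * max 0 (- y))))"
      using C0 by (intro mult_mono b1 b2 b3 b4) auto
    also have "\<dots> = C ^ 4 * exp (c / 2 / norm v - c * (\<bar>x\<bar> + \<bar>y\<bar>))"
    proof -
      have e: "max 0 x + max 0 (- x) = \<bar>x\<bar>" "max 0 y + max 0 (- y) = \<bar>y\<bar>" by auto
      have "(C * exp p) * (C * exp q) * ((C * exp p') * (C * exp q')) = C ^ 4 * exp (p + q + (p' + q'))"
        for p q p' q' :: real
        by (simp add: exp_add power4_eq_xxxx mult_ac)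
      then show ?thesis
        unfolding e[symmetric] by (simp add: algebra_simps)
    qed
    also have "\<dots> \<le> C ^ 4 * exp (c / 2 / norm v - c * (1 / norm v))"
    proof -
      have "1 / norm v \<le> \<bar>x\<bar> + \<bar>y\<bar>"
        using cmod_le[of "1 / v"] by (simp add: x_def y_def norm_divide)
      then have "c * (1 / norm v) \<le> c * (\<bar>x\<bar> + \<bar>y\<bar>)" using c by (intro mult_left_mono) auto
      then show ?thesis using C0 by (intro mult_left_mono) auto
    qed
    also have "c / 2 / norm v - c * (1 / norm v) = - (c / 2) / norm v" by (simp add: field_simps)
    finally show ?thesis .
  qed
  have "Q holomorphic_on ball 0 r - {0}"
  proof -
    have rot: "(\<lambda>v. g (a * v)) holomorphic_on ?S" if "norm a = 1" for a
    proof -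
      have "g \<circ> (\<lambda>v. a * v) holomorphic_on ?S"
        using that by (intro holomorphic_on_compose holomorphic_intros holomorphic_on_subset[OF hol])
          (auto simp: norm_mult)
      then show ?thesis by (simp add: o_def)
    qed
    have "(\<lambda>v. g (1 * v) * g ((-1) * v) * (g (\<i> * v) * g ((-\<i>) * v))) holomorphic_on ?S"
      by (intro holomorphic_intros rot) auto
    then show ?thesis
      by (rule holomorphic_transform) (auto simp: Q_def)
  qed
  \<comment> \<open>The decay of Q makes the singularity at 0 removable with value 0.\<close>
  moreover have "(Q \<longlongrightarrow> Q 0) (at 0 within ball 0 r)"
  proof -
    have "((\<lambda>x. C ^ 4 * exp (- (c / 2) / x)) \<longlongrightarrow> 0) (at_right 0)"
      using c by real_asymp
    then have "((\<lambda>v. C ^ 4 * exp (- (c / 2) / norm v)) \<longlongrightarrow> 0) (at (0 :: complex))"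
      by (rule filterlim_compose) (auto simp: filterlim_at tendsto_norm_zero eventually_at_filter)
    moreover have "\<forall>\<^sub>F v in at 0. norm (Q v) \<le> C ^ 4 * exp (- (c / 2) / norm v)"
      using r Qb unfolding eventually_at by (intro exI[of _ r]) auto
    ultimately have "(Q \<longlongrightarrow> 0) (at 0)"
      by (rule Lim_null_comparison[rotated])
    then show ?thesis by (simp add: Q_def Lim_at_imp_Lim_at_within)
  qed
  ultimately have holQ: "Q holomorphic_on ball 0 r"
    by (intro no_isolated_singularity'[of "{0}" Q "ball 0 r"]) simp_all
  have Q0: "Q w = 0" if w: "w \<in> ?S" for w
  proof (rule ccontr)
    assume "Q w \<noteq> 0"
    then have "Q w \<noteq> Q 0" by (simp add: Q_def)
    moreover have "0 \<in> ball 0 r" "w \<in> ball 0 r" using w r by auto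
    \<comment> \<open>A nonconstant holomorphic function departs from its value at 0 at least like k
      |w|^n, which exp (- c / (2 |w|)) eventually undercuts.\<close>
    ultimately obtain k n s where k: "k > 0" "s > 0"
      "\<And>w. w \<in> ball 0 s \<Longrightarrow> k * norm (w - 0) ^ n \<le> norm (Q w - Q 0)"
      using holomorphic_lower_bound_difference[OF holQ open_ball connected_ball] by metis
    have "\<forall>\<^sub>F x in at_right 0. C ^ 4 * exp (- (c / 2) / x) < k * x ^ n"
      using c k(1) C0 by real_asymp
    moreover have "\<forall>\<^sub>F x in at_right 0. x < s \<and> x < r \<and> x > (0 :: real)"
      using k(2) r by (intro eventually_conj eventually_at_right_less) (auto simp: eventually_at_right)
    ultimately have "\<forall>\<^sub>F x in at_right (0 :: real). False"
    proof eventually_elim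
      case (elim x)
      then have "k * x ^ n \<le> norm (Q (of_real x))" using k(3)[of "of_real x"] by (simp add: Q_def)
      also have "\<dots> \<le> C ^ 4 * exp (- (c / 2) / x)" using Qb[of "of_real x"] elim by simp
      finally show ?case using elim by simp
    qed
    then show False by simp
  qed
  define K where "K = sphere (0 :: complex) (r / 2)"
  define Z where "Z = {z \<in> K. g z = 0}"
  have "finite Z"
  proof (cases "g constant_on ?S")
    case True
    then have "Z = {}" using gv v r unfolding Z_def K_def constant_on_def by force
    then show ?thesis by simp
  next
    case False
    then show ?thesis unfolding Z_def K_def using r
      by (intro holomorphic_compact_finite_zeros[OF hol] connected_open_delete) auto
  qed
  have "K \<subseteq> Z \<union> uminus ` Z \<union> (\<lambda>z. - \<i> * z) ` Z \<union> (\<lambda>z. \<i> * z) ` Z"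
  proof
    fix w assume w: "w \<in> K"
    then have "w \<in> ?S" using r by (auto simp: K_def)
    then have "g w = 0 \<or> g (- w) = 0 \<or> g (\<i> * w) = 0 \<or> g (- (\<i> * w)) = 0"
      using Q0[of w] by (auto simp: Q_def)
    moreover have "- w \<in> K" "\<i> * w \<in> K" "- (\<i> * w) \<in> K" using w by (auto simp: K_def norm_mult)
    moreover have "w = - (- w)" "w = - \<i> * (\<i> * w)" "w = \<i> * (- (\<i> * w))" by (simp_all flip: mult.assoc)
    ultimately show "w \<in> Z \<union> uminus ` Z \<union> (\<lambda>z. - \<i> * z) ` Z \<union> (\<lambda>z. \<i> * z) ` Z"
      using w unfolding Z_def by blast
  qed
  then have "finite K" using \<open>finite Z\<close> by (meson finite_Un finite_imageI finite_subset)
  moreover have "infinite K"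
  proof -
    have "connected K" unfolding K_def by (rule connected_sphere) simp
    moreover have "of_real (r / 2) \<in> K" "- of_real (r / 2) \<in> K" "of_real (r / 2) \<noteq> (- of_real (r / 2) :: complex)"
      using r by (auto simp: K_def)
    ultimately show ?thesis using connected_finite_iff_sing[of K] by auto
  qed
  ultimately show False by blast
qed

section \<open>Rigidity and propagation\<close>

text \<open>The forward inequality applied to the reversed sequence with k-th term x (n + d - k). It
  estimates from the far end, where the limit will be known.\<close>

lemma backward_gronwall:
  fixes x a g :: "nat \<Rightarrow> real"
  assumes step: "\<And>k. x k \<le> (1 + a k) * (x (Suc k) + g k)"
    and nonneg: "\<And>k. a k \<ge> 0" "\<And>k. g k \<ge> 0" "\<And>k. x k \<ge> 0"
  shows "x n \<le> exp (\<Sum>k<d. a (n + k)) * (x (n + d) + (\<Sum>k<d. g (n + k)))"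
proof -
  define m where "m = n + d"
  have "x (m - d) \<le> exp (\<Sum>k<d. a (m - Suc k)) * (x (m - 0) + (\<Sum>k<d. g (m - Suc k)))"
  proof (rule discrete_gronwall)
    show "x (m - Suc k) \<le> (1 + a (m - Suc k)) * (x (m - k) + g (m - Suc k))" if "k < d" for k
      using step[of "m - Suc k"] that by (simp add: m_def Suc_diff_Suc)
  qed (use nonneg in auto)
  moreover have "(\<Sum>k<d. h (m - Suc k)) = (\<Sum>k<d. h (n + k))" for h :: "nat \<Rightarrow> real"
    by (subst sum.nat_diff_reindex[symmetric]) (auto simp: m_def intro!: sum.cong)
  ultimately show ?thesis by (simp add: m_def)
qed

lemma sum_geometric_le:
  fixes q :: real
  assumes "0 \<le> q" "q \<le> 1/2"
  shows "(\<Sum>k<n. q ^ k) \<le> 2"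
proof -
  have "(\<Sum>k<n. q ^ k) \<le> (\<Sum>k. q ^ k)"
    using assms by (intro sum_le_suminf summable_geometric) auto
  also have "\<dots> = 1 / (1 - q)" using assms by (intro suminf_geometric) auto
  also have "\<dots> \<le> 2" using assms by (simp add: field_simps)
  finally show ?thesis .
qed

text \<open>If the scattering function vanishes, then \<open>weyl \<beta> n\<close> decays on a circle faster than every
  geometric sequence as \<open>n \<rightarrow> \<infinity>\<close>, because \<open>\<beta>\<close> does.  By the maximum principle its supremum on
  the circle bounds its value \<open>- \<beta> (n - 1)\<close> at \<open>0\<close>, so the recurrence shows that this supremum
  cannot shrink faster than geometrically unless it is zero.\<close>

lemma scattering_zero_imp_zero:
  fixes \<beta> :: "int \<Rightarrow> real" and B :: real
  assumes bdd: "\<And>n. \<bar>\<beta> n\<bar> \<le> B" and decay: "factorial_decay \<beta>"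
    and zero: "\<And>v. v \<noteq> 0 \<Longrightarrow> norm v < radius B \<Longrightarrow> scattering \<beta> v = 0"
  shows "\<beta> n = 0"
proof -
  have B: "B \<ge> 0" using bound_nonneg[of \<beta> B, OF bdd] .
  define \<eta> where "\<eta> = radius B / 2"
  have \<eta>: "\<eta> > 0" "\<eta> < radius B" "\<eta> \<le> 1/8"
    using radius_pos[OF B] radius_le[OF B] by (auto simp: \<eta>_def)
  define P where "P n s \<longleftrightarrow> (\<forall>v. norm v = \<eta> \<longrightarrow> norm (weyl \<beta> n v) \<le> s)" for n s
  have beta_le: "\<bar>\<beta> n\<bar> \<le> s" if "P (n + 1) s" for n s
  proof -
    have "norm (weyl \<beta> (n + 1) 0) \<le> s"
    proof (rule maximum_modulus_frontier[where f = "weyl \<beta> (n + 1)" and \<xi> = 0 and S = "cball 0 \<eta>"])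
      show "weyl \<beta> (n + 1) holomorphic_on interior (cball 0 \<eta>)"
        using \<eta> by (intro holomorphic_on_subset[OF weyl_holomorphic[of \<beta> B, OF bdd]]) auto
      show "continuous_on (closure (cball 0 \<eta>)) (weyl \<beta> (n + 1))"
        using \<eta> by (intro holomorphic_on_imp_continuous_on holomorphic_on_subset[OF weyl_holomorphic[of \<beta> B, OF bdd]]) auto
    qed (use that \<eta> in \<open>auto simp: P_def dist_norm\<close>)
    then show ?thesis by (simp add: weyl_at_0[of \<beta> B, OF bdd])
  qed
  \<comment> \<open>Solving the recurrence for v x gives v x = y + \<beta> n - v x y, of norm at
    most s + s + s / 4.\<close>
  have backward: "P n (3 / \<eta> * s)" if s: "P (n + 1) s" for n s
    unfolding P_def
  proof (intro allI impI)
    fix v :: complex assume v: "norm v = \<eta>"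
    define x y where "x = weyl \<beta> n v" and "y = weyl \<beta> (n + 1) v"
    have vr: "norm v \<le> radius B" using v \<eta> by simp
    have q: "norm (v * x) \<le> 1/4"
      unfolding x_def by (intro norm_mult_le_quarter[OF B vr] weyl_bounded[of \<beta> B, OF bdd vr])
    then have "1 - v * x \<noteq> 0" by auto
    then have "y * (1 - v * x) = v * x - of_real (\<beta> n)"
      unfolding y_def weyl_recurrence[of \<beta> B, OF bdd vr] x_def[symmetric] weyl_step_def by simp
    then have "v * x = y + of_real (\<beta> n) - v * x * y"
      by (simp add: algebra_simps)
    then have "norm (v * x) \<le> norm y + \<bar>\<beta> n\<bar> + norm (v * x) * norm y"
      using norm_triangle_ineq4[of "y + of_real (\<beta> n)" "v * x * y"] norm_triangle_ineq[of y "of_real (\<beta> n)"]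
      by (simp add: norm_mult)
    moreover have ys: "norm y \<le> s" using s v by (simp add: P_def y_def)
    moreover have "norm (v * x) * norm y \<le> 1/4 * s"
      using q ys by (intro mult_mono) auto
    ultimately have "\<eta> * norm x \<le> 3 * s"
      using beta_le[OF s] order_trans[OF norm_ge_zero ys] v by (simp add: norm_mult)
    then show "norm (weyl \<beta> n v) \<le> 3 / \<eta> * s"
      using \<eta> by (simp add: x_def field_simps)
  qed
  have backward_iter: "P n ((3 / \<eta>) ^ d * s)" if "P (n + int d) s" for n s d
    using that
  proof (induction d arbitrary: s)
    case (Suc d)
    have "P (n + int d) (3 / \<eta> * s)" using backward[of "n + int d"] Suc.prems by (simp add: algebra_simps)
    from Suc.IH[OF this] show ?case by (simp add: mult_ac)
  qed simp
  \<comment> \<open>Chosen so that (3 / \<eta>) \<theta> = 1/2: the decay rate \<theta> beats the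
    loss 3 / \<eta> of each backward step.\<close>
  define \<theta> where "\<theta> = \<eta> / 6"
  have \<theta>: "\<theta> > 0" "\<theta> / \<eta> \<le> 1/2" using \<eta> by (auto simp: \<theta>_def)
  obtain K where K: "K \<ge> 0" "\<And>n. \<bar>\<beta> (int n)\<bar> \<le> K * \<theta> ^ n / fact n"
    using factorial_decayE[OF decay \<theta>(1)] by blast
  have K': "\<bar>\<beta> (int n)\<bar> \<le> K * \<theta> ^ n" for n
  proof -
    have "K * \<theta> ^ n / fact n \<le> K * \<theta> ^ n / 1" using K(1) \<theta>(1) by (intro divide_left_mono) auto
    then show ?thesis using K(2)[of n] by simp
  qed
  define S where "S = 2 * (2 * B + 1) + 4 * (2 * K)"
  define c where "c = exp S * (2 * K / \<eta>)"
  \<comment> \<open>Backward Gronwall from site n + d with d -> infinity, where the scaled values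
    tend to the scattering function, hence to 0. What remains is the tail of \<beta> from n on,
    which gives the rate \<theta>^n.\<close>
  have small: "P (int n) (c * \<theta> ^ n)" for n
    unfolding P_def
  proof (intro allI impI)
    fix v :: complex assume v: "norm v = \<eta>"
    have vr: "v \<noteq> 0" "norm v \<le> radius B" using v \<eta> by auto
    have step: "norm (scaled_weyl \<beta> k v) \<le> (1 + norm (weyl \<beta> (int k) v)) *
        (norm (scaled_weyl \<beta> (Suc k) v) + \<bar>\<beta> (int k)\<bar> / \<eta> ^ Suc k)" for k
    proof -
      define x y z where "x = weyl \<beta> (int k) v" and "y = scaled_weyl \<beta> (Suc k) v"
        and "z = of_real (\<beta> (int k)) / v ^ Suc k"
      have "1 - v * x \<noteq> 0"
        using mult_ne_one[OF B vr(2) weyl_bounded[of \<beta> B, OF bdd vr(2)]] by (auto simp: x_def)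
      then have "scaled_weyl \<beta> k v = y * (1 - v * x) + z"
        using scaled_weyl_Suc[of \<beta> B, OF bdd vr, of k]
        unfolding x_def[symmetric] y_def[symmetric] z_def[symmetric] by simp
      also have "norm \<dots> \<le> norm y * norm (1 - v * x) + norm z"
        by (rule order_trans[OF norm_triangle_ineq]) (simp add: norm_mult)
      also have "\<dots> \<le> norm y * (1 + norm x) + norm z * (1 + norm x)"
      proof (intro add_mono mult_left_mono)
        have "norm v * norm x \<le> 1 * norm x" using v \<eta> by (intro mult_right_mono) auto
        then show "norm (1 - v * x) \<le> 1 + norm x"
          using norm_triangle_ineq4[of 1 "v * x"] by (simp add: norm_mult)
        show "norm z \<le> norm z * (1 + norm x)" by (simp add: distrib_left)
      qed auto
      finally show ?thesis
        using v by (simp add: x_def y_def z_def norm_divide norm_mult norm_power algebra_simps)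
    qed
    have bound: "norm (scaled_weyl \<beta> n v) \<le> exp S * (norm (scaled_weyl \<beta> (n + d) v) + 2 * K / \<eta> * (\<theta> / \<eta>) ^ n)" for d
    proof -
      have "norm (scaled_weyl \<beta> n v) \<le> exp (\<Sum>k<d. norm (weyl \<beta> (int (n + k)) v)) *
          (norm (scaled_weyl \<beta> (n + d) v) + (\<Sum>k<d. \<bar>\<beta> (int (n + k))\<bar> / \<eta> ^ Suc (n + k)))"
        by (rule backward_gronwall[where x = "\<lambda>k. norm (scaled_weyl \<beta> k v)"
              and a = "\<lambda>k. norm (weyl \<beta> (int k) v)" and g = "\<lambda>k. \<bar>\<beta> (int k)\<bar> / \<eta> ^ Suc k", OF step])
          (use \<eta> in auto)
      also have "\<dots> \<le> exp S * (norm (scaled_weyl \<beta> (n + d) v) + 2 * K / \<eta> * (\<theta> / \<eta>) ^ n)"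
      proof (intro mult_mono add_mono order_refl)
        have "(\<Sum>k<n + d. \<bar>\<beta> (int k)\<bar>) \<le> (\<Sum>k<n + d. K * (1/2) ^ k)"
          using K' \<theta> \<eta> K(1)
          by (intro sum_mono order_trans[OF K'] mult_left_mono power_mono) (auto simp: \<theta>_def)
        also have "\<dots> = K * (\<Sum>k<n + d. (1/2) ^ k)" by (simp add: sum_distrib_left)
        also have "\<dots> \<le> K * 2" using K(1) by (intro mult_left_mono sum_geometric_le) auto
        finally have "(\<Sum>k<n + d. norm (weyl \<beta> (int k) v)) \<le> S"
          using sum_norm_weyl_le[of \<beta> B, OF bdd vr(2), of "n + d"] by (simp add: S_def)
        moreover have "(\<Sum>k<d. norm (weyl \<beta> (int (n + k)) v)) = (\<Sum>k=n..<n+d. norm (weyl \<beta> (int k) v))"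
          by (simp add: sum.shift_bounds_nat_ivl[of _ 0 n d, simplified add_0] atLeast0LessThan add.commute)
        moreover have "\<dots> \<le> (\<Sum>k<n + d. norm (weyl \<beta> (int k) v))"
          by (intro sum_mono2) auto
        ultimately show "exp (\<Sum>k<d. norm (weyl \<beta> (int (n + k)) v)) \<le> exp S" by simp
        have "(\<Sum>k<d. \<bar>\<beta> (int (n + k))\<bar> / \<eta> ^ Suc (n + k)) \<le> (\<Sum>k<d. K / \<eta> * (\<theta> / \<eta>) ^ n * (\<theta> / \<eta>) ^ k)"
        proof (rule sum_mono)
          fix k
          have "\<bar>\<beta> (int (n + k))\<bar> / \<eta> ^ Suc (n + k) \<le> K * \<theta> ^ (n + k) / \<eta> ^ Suc (n + k)"
            using K'[of "n + k"] \<eta> by (intro divide_right_mono) auto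
          then show "\<bar>\<beta> (int (n + k))\<bar> / \<eta> ^ Suc (n + k) \<le> K / \<eta> * (\<theta> / \<eta>) ^ n * (\<theta> / \<eta>) ^ k"
            by (simp add: power_add power_divide mult_ac)
        qed
        also have "\<dots> = K / \<eta> * (\<theta> / \<eta>) ^ n * (\<Sum>k<d. (\<theta> / \<eta>) ^ k)" by (simp add: sum_distrib_left)
        also have "\<dots> \<le> K / \<eta> * (\<theta> / \<eta>) ^ n * 2"
          using K(1) \<theta> \<eta> by (intro mult_left_mono sum_geometric_le) auto
        finally show "(\<Sum>k<d. \<bar>\<beta> (int (n + k))\<bar> / \<eta> ^ Suc (n + k)) \<le> 2 * K / \<eta> * (\<theta> / \<eta>) ^ n"
          by (simp add: mult_ac)
      qed (use \<eta> in \<open>auto intro!: add_nonneg_nonneg sum_nonneg\<close>)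
      finally show ?thesis .
    qed
    have "(\<lambda>d. scaled_weyl \<beta> (n + d) v) \<longlonglongrightarrow> 0"
      using LIMSEQ_ignore_initial_segment[OF scaled_weyl_tendsto[of \<beta> B, OF bdd decay vr], of n] zero[OF vr(1)] v \<eta>
      by (simp add: add.commute)
    then have "(\<lambda>d. exp S * (norm (scaled_weyl \<beta> (n + d) v) + 2 * K / \<eta> * (\<theta> / \<eta>) ^ n))
        \<longlonglongrightarrow> exp S * (0 + 2 * K / \<eta> * (\<theta> / \<eta>) ^ n)"
      by (intro tendsto_intros tendsto_norm_zero)
    then have "norm (scaled_weyl \<beta> n v) \<le> c * (\<theta> / \<eta>) ^ n"
      using LIMSEQ_le_const[of _ _ "norm (scaled_weyl \<beta> n v)"] bound by (simp add: c_def mult.assoc)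
    moreover have "norm (scaled_weyl \<beta> n v) = norm (weyl \<beta> (int n) v) / \<eta> ^ n"
      using v by (simp add: scaled_weyl_def norm_divide norm_power)
    ultimately show "norm (weyl \<beta> (int n) v) \<le> c * \<theta> ^ n"
      using \<eta> by (simp add: power_divide divide_le_cancel)
  qed
  \<comment> \<open>The bound at site k + d is carried back d steps; the accumulated factor (1/2)^d
    tends to 0.\<close>
  have zero_nat: "P (int k) 0" for k
    unfolding P_def
  proof (intro allI impI)
    fix v :: complex assume v: "norm v = \<eta>"
    have "norm (weyl \<beta> (int k) v) \<le> c * \<theta> ^ k * (1/2) ^ d" for d
    proof -
      have "P (int k) ((3 / \<eta>) ^ d * (c * \<theta> ^ (k + d)))"
        by (rule backward_iter) (use small[of "k + d"] in simp)
      moreover have "(3 / \<eta>) ^ d * \<theta> ^ d = (1/2) ^ d"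
        using \<eta> by (simp add: \<theta>_def flip: power_mult_distrib)
      then have "(3 / \<eta>) ^ d * (c * \<theta> ^ (k + d)) = c * \<theta> ^ k * (1/2) ^ d"
        by (simp add: power_add mult_ac)
      ultimately show ?thesis using v by (simp add: P_def)
    qed
    moreover have "(\<lambda>d. c * \<theta> ^ k * (1/2) ^ d) \<longlonglongrightarrow> c * \<theta> ^ k * 0"
      by (intro tendsto_intros LIMSEQ_power_zero) auto
    ultimately have "norm (weyl \<beta> (int k) v) \<le> c * \<theta> ^ k * 0"
      using LIMSEQ_le_const by blast
    then show "norm (weyl \<beta> (int k) v) \<le> 0" by simp
  qed
  \<comment> \<open>Any natural number that is at least n + 1 serves: the bound 0 at k is carried
    back to n + 1, whose value at v = 0 is - \<beta> n.\<close>
  define k where "k = nat \<bar>n + 1\<bar>"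
  have "n + 1 + int (nat (int k - (n + 1))) = int k" by (simp add: k_def)
  then have "P (n + 1 + int (nat (int k - (n + 1)))) 0" using zero_nat[of k] by simp
  from backward_iter[OF this] have "P (n + 1) 0" by simp
  from beta_le[OF this] show ?thesis by simp
qed

text \<open>The profile K \<theta>^n exp (c (t - a)) solves the comparison system because
  \<theta>^(n + 1) + \<theta>^(n - 1) = (\<theta> + 1 / \<theta>) \<theta>^n. Picard iteration from
  the a priori bound B adds an error B (2 D (t - a))^j / j!, which vanishes as j ->
  infinity.\<close>

lemma lattice_propagation:
  fixes u u' :: "int \<Rightarrow> real \<Rightarrow> real"
  assumes deriv: "\<And>n t. t \<in> {a..b} \<Longrightarrow> (u n has_real_derivative u' n t) (at t within {a..b})"
    and u'_le: "\<And>n t. t \<in> {a..b} \<Longrightarrow> \<bar>u' n t\<bar> \<le> D * (\<bar>u (n + 1) t\<bar> + \<bar>u (n - 1) t\<bar>)"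
    and bdd: "\<And>n t. t \<in> {a..b} \<Longrightarrow> \<bar>u n t\<bar> \<le> B"
    and init: "\<And>n. \<bar>u n a\<bar> \<le> K * \<theta> powi n"
    and pos: "D \<ge> 0" "K \<ge> 0" "\<theta> > 0"
    and t: "t \<in> {a..b}"
  shows "\<bar>u n t\<bar> \<le> K * \<theta> powi n * exp (D * (\<theta> + 1 / \<theta>) * (t - a))"
proof -
  define c where "c = D * (\<theta> + 1 / \<theta>)"
  have c: "c \<ge> 0" using pos by (simp add: c_def)
  have iter: "\<bar>u n t\<bar> \<le> K * \<theta> powi n * exp (c * (t - a)) + B * (2 * D * (t - a)) ^ j / fact j"
    if "t \<in> {a..b}" for n t j
    using that
  proof (induction j arbitrary: n t)
    case 0
    have "K * \<theta> powi n * exp (c * (t - a)) \<ge> 0" using pos by simp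
    then show ?case using bdd[OF 0, of n] by simp
  next
    case (Suc j)
    \<comment> \<open>The derivative \<phi>' is D times the sum of the induction hypotheses at the
      two neighbours; \<phi> is its integral with the right initial value.\<close>
    define \<phi> where "\<phi> s = K * \<theta> powi n * exp (c * (s - a)) + B * (2 * D * (s - a)) ^ Suc j / fact (Suc j)" for s
    define \<phi>' where "\<phi>' s = c * (K * \<theta> powi n * exp (c * (s - a))) + 2 * D * (B * (2 * D * (s - a)) ^ j / fact j)" for s
    have \<phi>_deriv: "(\<phi> has_real_derivative \<phi>' s) (at s within A)" for s A
      unfolding \<phi>_def \<phi>'_def
      by (auto intro!: derivative_eq_intros simp: field_simps simp del: of_nat_Suc power_Suc)
    have \<phi>_a: "\<phi> a = K * \<theta> powi n" by (simp add: \<phi>_def)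
    show ?case
    proof (cases "t = a")
      case True
      then show ?thesis using init[of n] by simp
    next
      case False
      then have at: "a < t" using Suc.prems by simp
      have "norm (u n t - u n a) \<le> \<phi> t - \<phi> a"
      proof (rule differentiable_bound_general[OF at, of _ _ "u' n" \<phi>'])
        show "continuous_on {a..t} (u n)"
          by (rule DERIV_continuous_on, rule DERIV_subset[OF deriv]) (use Suc.prems in auto)
        show "continuous_on {a..t} \<phi>"
          by (rule DERIV_continuous_on[OF \<phi>_deriv])
        show "(u n has_vector_derivative u' n s) (at s)" if "a < s" "s < t" for s
          using deriv[of s n] that Suc.prems at_within_Icc_at[of a s b]
          by (simp add: has_real_derivative_iff_has_vector_derivative)
        show "(\<phi> has_vector_derivative \<phi>' s) (at s)" for s
          using \<phi>_deriv has_real_derivative_iff_has_vector_derivative by blast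
        show "norm (u' n s) \<le> \<phi>' s" if "a < s" "s < t" for s
        proof -
          have s: "s \<in> {a..b}" using that Suc.prems by simp
          have "norm (u' n s) \<le> D * (\<bar>u (n + 1) s\<bar> + \<bar>u (n - 1) s\<bar>)"
            using u'_le[OF s] by simp
          also have "\<dots> \<le> D * ((K * \<theta> powi (n + 1) * exp (c * (s - a)) + B * (2 * D * (s - a)) ^ j / fact j) +
              (K * \<theta> powi (n - 1) * exp (c * (s - a)) + B * (2 * D * (s - a)) ^ j / fact j))"
            by (intro mult_left_mono add_mono Suc.IH s pos)
          also have "\<dots> = \<phi>' s"
            using pos by (simp add: \<phi>'_def c_def power_int_add power_int_diff field_simps)
          finally show ?thesis .
        qed
      qed
      then show ?thesis using init[of n] unfolding \<phi>_a by (simp add: \<phi>_def)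
    qed
  qed
  have "(\<lambda>j. K * \<theta> powi n * exp (c * (t - a)) + B * (inverse (fact j) *\<^sub>R (2 * D * (t - a)) ^ j))
      \<longlonglongrightarrow> K * \<theta> powi n * exp (c * (t - a)) + B * 0"
    by (intro tendsto_intros summable_LIMSEQ_zero summable_exp_generic)
  then show ?thesis
    using iter[OF t] LIMSEQ_le_const[of _ _ "\<bar>u n t\<bar>"] unfolding c_def
    by (simp add: field_simps)
qed

section \<open>Unique continuation\<close>

text \<open>Factorial decay at t0 is turned into geometric decay on the whole time interval, at a
  rate \<theta> adapted to the fixed v. This makes the nonlinear terms of the Riccati equation
  negligible after division by v^n and leaves the linear equation in the limit.\<close>

lemma scattering_evolution:
  fixes \<beta> :: "int \<Rightarrow> real \<Rightarrow> real"
  assumes bdd: "\<And>n t. t \<in> {t0..t1} \<Longrightarrow> \<bar>\<beta> n t\<bar> \<le> B"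
    and deriv: "\<And>n t. t \<in> {t0..t1} \<Longrightarrow>
      (\<beta> n has_real_derivative \<kappa> * (1 - \<beta> n t) * (\<beta> (n + 1) t - \<beta> (n - 1) t)) (at t within {t0..t1})"
    and le: "t0 < t1" and \<kappa>: "\<kappa> > 0"
    and decay: "factorial_decay (\<lambda>n. \<beta> n t0)" "factorial_decay (\<lambda>n. \<beta> n t1)"
    and v: "v \<noteq> 0" "norm v < radius B"
  shows "scattering (\<lambda>n. \<beta> n t1) v =
    exp ((t1 - t0) *\<^sub>R (of_real \<kappa> * (v - 1 / v))) * scattering (\<lambda>n. \<beta> n t0) v"
proof -
  have B: "B \<ge> 0" using bdd[of t0 0] le by simp
  have vr: "norm v \<le> radius B" "norm v \<le> 1/8" "norm v > 0"
    using v radius_le[OF B] by auto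
  \<comment> \<open>With this rate \<beta> n / v^n is of order 2^(-n).\<close>
  define \<theta> where "\<theta> = norm v / 2"
  have \<theta>: "\<theta> > 0" "\<theta> \<le> 1/2" "\<theta> / norm v = 1/2" using vr by (auto simp: \<theta>_def)
  obtain K0 where K0: "K0 \<ge> 0" "\<And>n. \<bar>\<beta> (int n) t0\<bar> \<le> K0 * \<theta> ^ n / fact n"
    using factorial_decayE[OF decay(1) \<theta>(1)] by blast
  \<comment> \<open>At negative sites \<open>\<theta> powi n \<ge> 1\<close>, so there the uniform
    bound B suffices.\<close>
  define K1 where "K1 = max K0 B"
  have init: "\<bar>\<beta> n t0\<bar> \<le> K1 * \<theta> powi n" for n
  proof (cases "n \<ge> 0")
    case True
    have "K0 * \<theta> ^ nat n / fact (nat n) \<le> K0 * \<theta> ^ nat n / 1"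
      using K0(1) \<theta>(1) by (intro divide_left_mono) auto
    also have "\<dots> \<le> K1 * \<theta> ^ nat n" using \<theta>(1) by (auto simp: K1_def intro!: mult_right_mono)
    finally show ?thesis using K0(2)[of "nat n"] True by (simp add: power_int_def)
  next
    case False
    have "1 \<le> inverse \<theta> ^ nat (- n)" using \<theta> by (intro one_le_power) (simp add: field_simps)
    then have "B * 1 \<le> K1 * \<theta> powi n"
      using False B by (intro mult_mono) (auto simp: K1_def power_int_def)
    then show ?thesis using bdd[of t0 n] le by simp
  qed
  define K where "K = K1 * exp (\<kappa> * (1 + B) * (\<theta> + 1 / \<theta>) * (t1 - t0))"
  have K1: "K1 \<ge> 0" using B by (simp add: K1_def)
  have K: "K \<ge> 0" using K1 by (simp add: K_def)
  have small: "\<bar>\<beta> (int n) t\<bar> \<le> K * \<theta> ^ n" if t: "t \<in> {t0..t1}" for n t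
  proof -
    have "\<bar>\<beta> (int n) t\<bar> \<le> K1 * \<theta> powi (int n) * exp (\<kappa> * (1 + B) * (\<theta> + 1 / \<theta>) * (t - t0))"
    proof (rule lattice_propagation[OF deriv _ bdd init _ K1 \<theta>(1) t])
      fix n t assume t: "t \<in> {t0..t1}"
      have "\<bar>1 - \<beta> n t\<bar> \<le> 1 + B" using bdd[OF t, of n] by auto
      then show "\<bar>\<kappa> * (1 - \<beta> n t) * (\<beta> (n + 1) t - \<beta> (n - 1) t)\<bar>
          \<le> \<kappa> * (1 + B) * (\<bar>\<beta> (n + 1) t\<bar> + \<bar>\<beta> (n - 1) t\<bar>)"
        unfolding abs_mult using \<kappa> B by (intro mult_mono) auto
    qed (use \<kappa> B in auto)
    also have "\<dots> \<le> K1 * \<theta> ^ n * exp (\<kappa> * (1 + B) * (\<theta> + 1 / \<theta>) * (t1 - t0))"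
      unfolding power_int_of_nat using K1 \<theta> \<kappa> B t by (intro mult_left_mono) (auto intro!: mult_left_mono)
    finally show ?thesis by (simp add: K_def mult_ac)
  qed
  define M where "M = exp (2 * (2 * B + 1) + 4 * (2 * K)) * (2 * B + 1 + 2 * K / norm v)"
  have M: "norm (weyl (\<lambda>k. \<beta> k t) (int n) v) \<le> M * norm v ^ n" if t: "t \<in> {t0..t1}" for n t
  proof -
    have "(\<Sum>k<n. \<bar>\<beta> (int k) t\<bar>) \<le> (\<Sum>k<n. K * \<theta> ^ k)" by (intro sum_mono small t)
    also have "\<dots> = K * (\<Sum>k<n. \<theta> ^ k)" by (simp add: sum_distrib_left)
    also have "\<dots> \<le> K * 2" using K \<theta> by (intro mult_left_mono sum_geometric_le) auto
    finally have S: "(\<Sum>k<n. \<bar>\<beta> (int k) t\<bar>) \<le> 2 * K" by simp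
    have "(\<Sum>k<n. \<bar>\<beta> (int k) t\<bar> / norm v ^ Suc k) \<le> (\<Sum>k<n. K / norm v * (1/2) ^ k)"
    proof (rule sum_mono)
      fix k
      have "\<bar>\<beta> (int k) t\<bar> / norm v ^ Suc k \<le> K * \<theta> ^ k / norm v ^ Suc k"
        using small[OF t] vr by (intro divide_right_mono) auto
      also have "\<dots> = K / norm v * (\<theta> / norm v) ^ k" by (simp add: power_divide)
      finally show "\<bar>\<beta> (int k) t\<bar> / norm v ^ Suc k \<le> K / norm v * (1/2) ^ k" by (simp only: \<theta>(3))
    qed
    also have "\<dots> = K / norm v * (\<Sum>k<n. (1/2) ^ k)" by (simp add: sum_distrib_left)
    also have "\<dots> \<le> K / norm v * 2" using K vr by (intro mult_left_mono sum_geometric_le) auto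
    finally have "(\<Sum>k<n. \<bar>\<beta> (int k) t\<bar> / norm v ^ Suc k) \<le> 2 * K / norm v" by (simp add: mult.commute)
    then have "norm (scaled_weyl (\<lambda>k. \<beta> k t) n v) \<le> M"
      unfolding M_def
      by (intro order_trans[OF norm_scaled_weyl_le[of "\<lambda>k. \<beta> k t" B, OF bdd[OF t] v(1) vr(1) S]]
        mult_left_mono add_left_mono) auto
    then show ?thesis
      using vr by (simp add: scaled_weyl_def norm_divide norm_power field_simps)
  qed
  define c where "c = of_real \<kappa> * (v - 1 / v)"
  define A where "A = (t1 - t0) * exp ((t1 - t0) * norm c)"
  define Z where "Z t n = scaled_weyl (\<lambda>k. \<beta> k t) n v" for t n
  \<comment> \<open>The evolution estimate at site n + 1, where both \<beta> n and \<beta> (n + 1)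
    have natural indices, divided by |v|^(n + 1): the quadratic term leaves a factor |v|^(n + 1),
    the terms in \<beta> leave 2^(-n).\<close>
  have bound: "norm (exp (- (t1 - t0) *\<^sub>R c) * Z t1 (Suc n) - Z t0 (Suc n))
    \<le> A * \<kappa> * (2 * M\<^sup>2 * norm v ^ Suc n + 8 * (B + 1) * K / norm v ^ 2 * (1/2) ^ n)" for n
  proof -
    have "norm (exp (- (t1 - t0) *\<^sub>R c) * weyl (\<lambda>k. \<beta> k t1) (int (Suc n)) v - weyl (\<lambda>k. \<beta> k t0) (int (Suc n)) v)
      \<le> (t1 - t0) * exp ((t1 - t0) * norm c) *
        (\<kappa> * (2 * (M * norm v ^ Suc n)\<^sup>2 + 8 * (B + 1) * (K * \<theta> ^ n) / norm v))"
    proof (rule weyl_evolution_approx[OF bdd deriv le \<kappa> vr(3,1)])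
      fix t assume t: "t \<in> {t0..t1}"
      show "norm (weyl (\<lambda>k. \<beta> k t) (int (Suc n)) v) \<le> M * norm v ^ Suc n" by (rule M[OF t])
      show "\<bar>\<beta> (int (Suc n) - 1) t\<bar> \<le> K * \<theta> ^ n" using small[OF t, of n] by simp
      have "K * \<theta> ^ Suc n \<le> K * \<theta> ^ n" using K \<theta> by (intro mult_left_mono power_decreasing) auto
      then show "\<bar>\<beta> (int (Suc n)) t\<bar> \<le> K * \<theta> ^ n" using small[OF t, of "Suc n"] by simp
    qed (simp_all add: c_def)
    also have "\<dots> = A * \<kappa> * (2 * M\<^sup>2 * norm v ^ Suc n + 8 * (B + 1) * K / norm v ^ 2 * (1/2) ^ n) * norm v ^ Suc n"
      using vr(3) by (simp add: A_def \<theta>_def power_divide field_simps power2_eq_square)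
    finally have "norm (exp (- (t1 - t0) *\<^sub>R c) * weyl (\<lambda>k. \<beta> k t1) (int (Suc n)) v - weyl (\<lambda>k. \<beta> k t0) (int (Suc n)) v)
      / norm v ^ Suc n \<le> A * \<kappa> * (2 * M\<^sup>2 * norm v ^ Suc n + 8 * (B + 1) * K / norm v ^ 2 * (1/2) ^ n)"
      using vr(3) by (simp only: pos_divide_le_eq zero_less_power)
    moreover have "exp (- (t1 - t0) *\<^sub>R c) * Z t1 (Suc n) - Z t0 (Suc n) =
      (exp (- (t1 - t0) *\<^sub>R c) * weyl (\<lambda>k. \<beta> k t1) (int (Suc n)) v - weyl (\<lambda>k. \<beta> k t0) (int (Suc n)) v) / v ^ Suc n"
      by (simp only: Z_def scaled_weyl_def diff_divide_distrib times_divide_eq_right)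
    ultimately show ?thesis by (simp only: norm_divide norm_power)
  qed
  have lim: "(\<lambda>n. Z t (Suc n)) \<longlonglongrightarrow> scattering (\<lambda>n. \<beta> n t) v" if "t \<in> {t0..t1}" "factorial_decay (\<lambda>n. \<beta> n t)" for t
    unfolding Z_def by (rule LIMSEQ_Suc, rule scaled_weyl_tendsto[of _ B, OF bdd[OF that(1)] that(2) v(1) vr(1)])
  have "(\<lambda>n. exp (- (t1 - t0) *\<^sub>R c) * Z t1 (Suc n) - Z t0 (Suc n)) \<longlonglongrightarrow>
    exp (- (t1 - t0) *\<^sub>R c) * scattering (\<lambda>n. \<beta> n t1) v - scattering (\<lambda>n. \<beta> n t0) v"
    using le decay by (intro tendsto_intros lim) auto
  moreover have "(\<lambda>n. exp (- (t1 - t0) *\<^sub>R c) * Z t1 (Suc n) - Z t0 (Suc n)) \<longlonglongrightarrow> 0"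
  proof (rule Lim_null_comparison[OF always_eventually[OF allI[OF bound]]])
    have "(\<lambda>n. A * \<kappa> * (2 * M\<^sup>2 * norm v ^ Suc n + 8 * (B + 1) * K / norm v ^ 2 * (1/2) ^ n))
      \<longlonglongrightarrow> A * \<kappa> * (2 * M\<^sup>2 * 0 + 8 * (B + 1) * K / norm v ^ 2 * 0)"
      using vr by (intro tendsto_intros LIMSEQ_Suc LIMSEQ_power_zero) auto
    then show "(\<lambda>n. A * \<kappa> * (2 * M\<^sup>2 * norm v ^ Suc n + 8 * (B + 1) * K / norm v ^ 2 * (1/2) ^ n)) \<longlonglongrightarrow> 0"
      by simp
  qed
  ultimately have "exp (- (t1 - t0) *\<^sub>R c) * scattering (\<lambda>n. \<beta> n t1) v = scattering (\<lambda>n. \<beta> n t0) v"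
    using LIMSEQ_unique by fastforce
  then have "exp ((t1 - t0) *\<^sub>R c) * scattering (\<lambda>n. \<beta> n t0) v =
      (exp ((t1 - t0) *\<^sub>R c) * exp (- (t1 - t0) *\<^sub>R c)) * scattering (\<lambda>n. \<beta> n t1) v"
    by (simp add: mult.assoc)
  also have "exp ((t1 - t0) *\<^sub>R c) * exp (- (t1 - t0) *\<^sub>R c) = 1"
    by (simp only: scaleR_minus_left exp_minus right_inverse[OF exp_not_eq_zero])
  finally show ?thesis by (simp add: c_def)
qed

theorem lattice_unique_continuation:
  fixes \<beta> :: "int \<Rightarrow> real \<Rightarrow> real"
  assumes bdd: "\<And>n t. t \<in> {t0..t1} \<Longrightarrow> \<bar>\<beta> n t\<bar> \<le> B"
    and deriv: "\<And>n t. t \<in> {t0..t1} \<Longrightarrow>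
      (\<beta> n has_real_derivative \<kappa> * (1 - \<beta> n t) * (\<beta> (n + 1) t - \<beta> (n - 1) t)) (at t within {t0..t1})"
    and le: "t0 < t1" and \<kappa>: "\<kappa> > 0"
    and decay: "factorial_decay (\<lambda>n. \<beta> n t0)" "factorial_decay (\<lambda>n. \<beta> n t1)"
  shows "\<beta> n t1 = 0"
proof -
  have B: "B \<ge> 0" using bdd[of t0 0] le by simp
  have bdd0: "\<bar>\<beta> n t0\<bar> \<le> B" and bdd1: "\<bar>\<beta> n t1\<bar> \<le> B" for n
    using bdd le by auto
  \<comment> \<open>The scattering functions at t0 and t1 play the roles of f and g, with c = (t1 -
    t0) \<kappa>; |exp w| = exp (Re w) turns the evolution into the relation between moduli.\<close>
  have "scattering (\<lambda>n. \<beta> n t1) v = 0" if v: "v \<noteq> 0" "norm v < radius B" for v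
  proof (rule minimal_type_vanishing[OF radius_pos[OF B] _ _ _ _ _ v])
    show "(t1 - t0) * \<kappa> > 0" using le \<kappa> by simp
    show "scattering (\<lambda>n. \<beta> n t1) holomorphic_on ball 0 (radius B) - {0}"
      by (rule scattering_holomorphic[of _ B, OF bdd1 decay(2)])
    show "norm (scattering (\<lambda>n. \<beta> n t1) v) = norm (scattering (\<lambda>n. \<beta> n t0) v) * exp ((t1 - t0) * \<kappa> * Re (v - 1 / v))"
      if "v \<noteq> 0" "norm v < radius B" for v
      using scattering_evolution[OF bdd deriv le \<kappa> decay that]
      by (simp add: norm_mult mult_ac)
    show "\<exists>C. \<forall>v. v \<noteq> 0 \<longrightarrow> norm v < radius B \<longrightarrow> norm (scattering (\<lambda>n. \<beta> n t0) v) \<le> C * exp (\<epsilon> / norm v)"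
      if "\<epsilon> > 0" for \<epsilon>
      using scattering_growth[of _ B, OF bdd0 decay(1) that] by (metis less_imp_le)
    show "\<exists>C. \<forall>v. v \<noteq> 0 \<longrightarrow> norm v < radius B \<longrightarrow> norm (scattering (\<lambda>n. \<beta> n t1) v) \<le> C * exp (\<epsilon> / norm v)"
      if "\<epsilon> > 0" for \<epsilon>
      using scattering_growth[of _ B, OF bdd1 decay(2) that] by (metis less_imp_le)
  qed
  from scattering_zero_imp_zero[of "\<lambda>n. \<beta> n t1" B, OF bdd1 decay(2) this] show ?thesis .
qed

section \<open>Decay of the given sequence and uniqueness for all times\<close>

lemma factorial_decay_of_powr_bound:
  assumes "\<And>n. n > 0 \<Longrightarrow> \<bar>\<beta> (int n)\<bar> \<le> C / real n powr ((1 + \<delta>) * 2 * real n)" "\<delta> > 0"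
  shows "factorial_decay \<beta>"
  unfolding factorial_decay_def
proof (intro allI impI)
  fix \<epsilon> :: real assume \<epsilon>: "\<epsilon> > 0"
  \<comment> \<open>The power n^(2 n) dominates (n!)^2: one factorial is kept, the other absorbs
    \<epsilon>^(-n), because (1 / \<epsilon>)^n / n! \<le> exp (1 / \<epsilon>). The summand
    |\<beta> 0| covers n = 0, where no decay is assumed.\<close>
  have "\<bar>\<beta> (int n)\<bar> \<le> (\<bar>C\<bar> * exp (1 / \<epsilon>) + \<bar>\<beta> 0\<bar>) * \<epsilon> ^ n / fact n" for n
  proof (cases "n = 0")
    case False
    have "real n powr (2 * real n) \<le> real n powr ((1 + \<delta>) * 2 * real n)"
      using False assms(2) by (intro powr_mono) (auto simp: algebra_simps)
    moreover have "real n powr (2 * real n) = real n ^ n * real n ^ n"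
      using powr_realpow[of "real n" "n + n"] False by (simp only: power_add of_nat_add mult_2)
    moreover have fact_le: "fact n \<le> real n ^ n"
      using fact_le_power[of n, where 'a = real] by simp
    then have "real n ^ n * real n ^ n \<ge> fact n * fact n" by (intro mult_mono) auto
    ultimately have "real n powr ((1 + \<delta>) * 2 * real n) \<ge> fact n * fact n" by linarith
    then have "\<bar>C\<bar> / real n powr ((1 + \<delta>) * 2 * real n) \<le> \<bar>C\<bar> / (fact n * fact n)"
      using False by (intro divide_left_mono) auto
    moreover have "C / real n powr ((1 + \<delta>) * 2 * real n) \<le> \<bar>C\<bar> / real n powr ((1 + \<delta>) * 2 * real n)"
      by (intro divide_right_mono) auto
    ultimately have "\<bar>\<beta> (int n)\<bar> \<le> \<bar>C\<bar> / (fact n * fact n)"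
      using assms(1)[of n] False by linarith
    also have "\<dots> = \<bar>C\<bar> * ((1 / \<epsilon>) ^ n / fact n) * \<epsilon> ^ n / fact n"
      using \<epsilon> by (simp add: power_divide)
    also have "\<dots> \<le> (\<bar>C\<bar> * exp (1 / \<epsilon>) + \<bar>\<beta> 0\<bar>) * \<epsilon> ^ n / fact n"
    proof (intro divide_right_mono mult_right_mono)
      have "(1 / \<epsilon>) ^ n / fact n \<le> (\<Sum>k<Suc n. (1 / \<epsilon>) ^ k / fact k)"
        using \<epsilon> by (intro member_le_sum) auto
      also have "\<dots> \<le> exp (1 / \<epsilon>)" using \<epsilon> by (intro sum_power_div_fact_le_exp) auto
      finally have "\<bar>C\<bar> * ((1 / \<epsilon>) ^ n / fact n) \<le> \<bar>C\<bar> * exp (1 / \<epsilon>)" by (intro mult_left_mono) auto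
      then show "\<bar>C\<bar> * ((1 / \<epsilon>) ^ n / fact n) \<le> \<bar>C\<bar> * exp (1 / \<epsilon>) + \<bar>\<beta> 0\<bar>" by linarith
    qed (use \<epsilon> in auto)
    finally show ?thesis .
  qed simp
  then show "\<exists>K. \<forall>n. \<bar>\<beta> (int n)\<bar> \<le> K * \<epsilon> ^ n / fact n" by blast
qed

text \<open>By \<open>lattice_propagation\<close> with K = 0 and \<theta> = 1 the zero state
  persists at later times. Earlier times follow by reversing time, which changes the sign of the
  right-hand side but not its bound.\<close>

lemma lattice_uniqueness:
  fixes \<beta> :: "int \<Rightarrow> real \<Rightarrow> real"
  assumes deriv: "\<And>n t. (\<beta> n has_real_derivative \<kappa> * (1 - \<beta> n t) * (\<beta> (n + 1) t - \<beta> (n - 1) t)) (at t)"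
    and bdd: "\<And>T. \<exists>B. \<forall>n t. \<bar>t\<bar> \<le> T \<longrightarrow> \<bar>\<beta> n t\<bar> \<le> B"
    and zero: "\<And>n. \<beta> n s = 0"
  shows "\<beta> n t = 0"
proof -
  obtain B where B: "\<And>n r. \<bar>r\<bar> \<le> max \<bar>s\<bar> \<bar>t\<bar> \<Longrightarrow> \<bar>\<beta> n r\<bar> \<le> B" using bdd by blast
  have B0: "B \<ge> 0" using B[of s 0] by linarith
  have rhs: "\<bar>\<kappa> * (1 - \<beta> n r) * (\<beta> (n + 1) r - \<beta> (n - 1) r)\<bar>
      \<le> \<bar>\<kappa>\<bar> * (1 + B) * (\<bar>\<beta> (n + 1) r\<bar> + \<bar>\<beta> (n - 1) r\<bar>)" if "\<bar>r\<bar> \<le> max \<bar>s\<bar> \<bar>t\<bar>" for n r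
    unfolding abs_mult using B[OF that, of n] B0 by (intro mult_mono) auto
  show ?thesis
  proof (cases "s \<le> t")
    case True
    have "\<bar>\<beta> n t\<bar> \<le> 0 * 1 powi n * exp (\<bar>\<kappa>\<bar> * (1 + B) * (1 + 1 / 1) * (t - s))"
      by (rule lattice_propagation[OF has_field_derivative_at_within[OF deriv] rhs B, where b = t])
        (use True B0 zero in auto)
    then show ?thesis by simp
  next
    case False
    have "((\<lambda>r. \<beta> n (- r)) has_real_derivative - (\<kappa> * (1 - \<beta> n (- r)) * (\<beta> (n + 1) (- r) - \<beta> (n - 1) (- r)))) (at r within A)"
      for n r A
      using DERIV_chain2[OF deriv DERIV_minus[OF DERIV_ident], of n r UNIV]
      by (auto intro: has_field_derivative_at_within)
    then have "\<bar>\<beta> n (- (- t))\<bar> \<le> 0 * 1 powi n * exp (\<bar>\<kappa>\<bar> * (1 + B) * (1 + 1 / 1) * (- t - (- s)))"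
    proof (rule lattice_propagation[where b = "- t" and u = "\<lambda>n r. \<beta> n (- r)"])
      fix n r assume "r \<in> {- s..- t}"
      then have r: "\<bar>- r\<bar> \<le> max \<bar>s\<bar> \<bar>t\<bar>" by auto
      show "\<bar>- (\<kappa> * (1 - \<beta> n (- r)) * (\<beta> (n + 1) (- r) - \<beta> (n - 1) (- r)))\<bar>
          \<le> \<bar>\<kappa>\<bar> * (1 + B) * (\<bar>\<beta> (n + 1) (- r)\<bar> + \<bar>\<beta> (n - 1) (- r)\<bar>)"
        using rhs[OF r] by simp
      show "\<bar>\<beta> n (- r)\<bar> \<le> B" by (rule B[OF r])
    qed (use False B0 zero in auto)
    then show ?thesis by simp
  qed
qed

theorem theorem1p2:
  fixes \<rho> :: "int \<Rightarrow> real \<Rightarrow> real" and \<rho>0 t0 t1 \<delta> C :: real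
  assumes "\<rho>0 > 0"
    and "kvm_solution \<rho>"
    and "\<exists>t. (\<lambda>n. \<bar>real_of_int n\<bar> * \<bar>\<rho> n t - \<rho>0\<bar>) summable_on UNIV"
    and "t0 < t1" and "\<delta> > 0"
    and "\<And>t M. t \<in> {t0, t1} \<Longrightarrow> M > 0 \<Longrightarrow>
           (\<lambda>n. \<bar>\<rho> n t - \<rho>0\<bar>) summable_on {M..} \<and>
           (\<Sum>\<^sub>\<infinity>n\<in>{M..}. \<bar>\<rho> n t - \<rho>0\<bar>)
             \<le> C * (1 / real_of_int M powr ((1 + \<delta>) * 2 * real_of_int M))"
  shows "\<forall>n t. \<rho> n t = \<rho>0"
proof -
  have pos: "\<rho> n t > 0" and bdd: "bounded {\<rho> n t | n t. \<bar>t\<bar> \<le> T}"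
    and deriv: "(\<rho> n has_real_derivative \<rho> n t * ((\<rho> (n + 1) t)\<^sup>2 - (\<rho> (n - 1) t)\<^sup>2)) (at t)" for n t T
    using assms(2) unfolding kvm_solution_def by auto
  define \<beta> where "\<beta> n t = 1 - (\<rho> n t)\<^sup>2 / \<rho>0\<^sup>2" for n t
  \<comment> \<open>Writing each square as \<open>\<rho>0\<^sup>2 * (1 - \<beta>)\<close> turns the
    cubic lattice equation into a quadratic one for \<beta>.\<close>
  have \<beta>_deriv: "(\<beta> n has_real_derivative 2 * \<rho>0\<^sup>2 * (1 - \<beta> n t) * (\<beta> (n + 1) t - \<beta> (n - 1) t)) (at t)" for n t
    unfolding \<beta>_def using assms(1)
    by (auto intro!: derivative_eq_intros deriv simp: field_simps power2_eq_square)
  have bound: "\<exists>A>0. \<forall>n t. \<bar>t\<bar> \<le> T \<longrightarrow> \<bar>\<rho> n t\<bar> \<le> A" for T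
  proof -
    obtain A where "A > 0" "\<forall>x\<in>{\<rho> n t | n t. \<bar>t\<bar> \<le> T}. norm x \<le> A"
      using bdd[of T] by (meson bounded_pos)
    then show ?thesis by (intro exI[of _ A]) auto
  qed
  have \<beta>_bound: "\<exists>B. \<forall>n t. \<bar>t\<bar> \<le> T \<longrightarrow> \<bar>\<beta> n t\<bar> \<le> B" for T
  proof -
    obtain A where A: "A > 0" "\<And>n t. \<bar>t\<bar> \<le> T \<Longrightarrow> \<bar>\<rho> n t\<bar> \<le> A" using bound by blast
    have "\<bar>\<beta> n t\<bar> \<le> 1 + A\<^sup>2 / \<rho>0\<^sup>2" if "\<bar>t\<bar> \<le> T" for n t
    proof -
      have "(\<rho> n t)\<^sup>2 / \<rho>0\<^sup>2 \<le> A\<^sup>2 / \<rho>0\<^sup>2"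
        using A(2)[OF that, of n] A(1) by (intro divide_right_mono) (auto simp: power2_le_iff_abs_le)
      moreover have "(\<rho> n t)\<^sup>2 / \<rho>0\<^sup>2 \<ge> 0" by simp
      ultimately show ?thesis unfolding \<beta>_def by linarith
    qed
    then show ?thesis by blast
  qed
  have decay: "factorial_decay (\<lambda>n. \<beta> n t)" if t: "t \<in> {t0, t1}" for t
  proof -
    obtain A where A: "A > 0" "\<And>n. \<bar>\<rho> n t\<bar> \<le> A" using bound[of "\<bar>t\<bar>"] by auto
    show ?thesis
    proof (rule factorial_decay_of_powr_bound[OF _ assms(5)])
      fix n :: nat assume n: "n > 0"
      \<comment> \<open>A single deviation is at most the tail sum that starts at its own
        site.\<close>
      have "\<bar>\<rho> (int n) t - \<rho>0\<bar> = (\<Sum>\<^sub>\<infinity>k\<in>{int n}. \<bar>\<rho> k t - \<rho>0\<bar>)" by simp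
      also have "\<dots> \<le> (\<Sum>\<^sub>\<infinity>k\<in>{int n..}. \<bar>\<rho> k t - \<rho>0\<bar>)"
        using assms(6)[OF t, of "int n"] n by (intro infsum_mono_neutral) auto
      also have "\<dots> \<le> C * (1 / real n powr ((1 + \<delta>) * 2 * real n))"
        using assms(6)[OF t, of "int n"] n by simp
      finally have le: "\<bar>\<rho> (int n) t - \<rho>0\<bar> \<le> C / real n powr ((1 + \<delta>) * 2 * real n)" by simp
      \<comment> \<open>Difference of squares: the factor \<rho> + \<rho>0 is at most A + \<rho>0,
        so \<beta> inherits the decay of \<rho> - \<rho>0.\<close>
      have "\<bar>\<beta> (int n) t\<bar> = \<bar>\<rho> (int n) t - \<rho>0\<bar> * ((\<rho> (int n) t + \<rho>0) / \<rho>0\<^sup>2)"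
      proof -
        have "\<beta> (int n) t = - (\<rho> (int n) t - \<rho>0) * ((\<rho> (int n) t + \<rho>0) / \<rho>0\<^sup>2)"
          using assms(1) by (simp add: \<beta>_def field_simps power2_eq_square)
        then show ?thesis using pos[of "int n" t] assms(1) by (simp add: abs_mult)
      qed
      also have "\<dots> \<le> C / real n powr ((1 + \<delta>) * 2 * real n) * ((A + \<rho>0) / \<rho>0\<^sup>2)"
        using le A(2)[of "int n"] pos[of "int n" t] assms(1) order_trans[OF abs_ge_zero le]
        by (intro mult_mono divide_right_mono) auto
      finally show "\<bar>\<beta> (int n) t\<bar> \<le> C * ((A + \<rho>0) / \<rho>0\<^sup>2) / real n powr ((1 + \<delta>) * 2 * real n)"
        by (simp add: mult_ac)
    qed
  qed
  obtain B where B: "\<And>n t. \<bar>t\<bar> \<le> max \<bar>t0\<bar> \<bar>t1\<bar> \<Longrightarrow> \<bar>\<beta> n t\<bar> \<le> B" using \<beta>_bound by blast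
  have "\<beta> n t1 = 0" for n
    by (rule lattice_unique_continuation[OF B has_field_derivative_at_within[OF \<beta>_deriv] assms(4) _ decay decay])
      (use assms(1) in auto)
  then have zero: "\<beta> n t = 0" for n t
    by (rule lattice_uniqueness[OF \<beta>_deriv \<beta>_bound])
  show ?thesis
  proof (intro allI)
    fix n t
    have "(\<rho> n t)\<^sup>2 = \<rho>0\<^sup>2" using zero[of n t] assms(1) by (simp add: \<beta>_def)
    \<comment> \<open>Positivity excludes the root - \<rho>0.\<close>
    then show "\<rho> n t = \<rho>0" using pos[of n t] assms(1) by (simp add: power2_eq_iff)
  qed
qed

end
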